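(* Let $(M^n,g)$ be a Ricci flat Riemannian manifold with $n=\dim M\ge 2$ and scalar curvature $r$, let $f>0$ be a smooth function on $M$, and let $\tilde M = M\times_f \mathbb{R}$, with metric $\tilde g=g-f^2dt^2$, be a static perfect fluid spacetime. Let $(\tilde g,\tilde\lambda,\tilde\phi)$ be an almost gradient Ricci soliton on $\tilde M$ with $H^\phi=0$ on $M$, where $\phi=\tilde\phi|_M$. Then $\tilde M$ satisfies the null convergence condition if $$\tilde\lambda\le-\frac{r}{n-1}.$$
   Context: The static spacetime $M\times_f\mathbb{R}$ is $M\times\mathbb{R}$ with the Lorentzian metric $\tilde g=g-f^2dt^2$, $t$ being the coordinate on $\mathbb{R}$. It is a static perfect fluid (SPF) spacetime with isotropic pressure $\rho$ (a smooth function) if, with $S$, $r$ the Ricci tensor and scalar curvature of $(M,g)$ and $H^f,\triangle f$ the Hessian and Laplacian (trace of the Hessian) of $f$ on $(M,g)$, $$f\Big(S-\frac rn g\Big)=H^f-\frac{\triangle f}{n}g,\qquad \triangle f=\Big(\frac{n-2}{2(n-1)}r+\frac{n}{n-1}\rho\Big)f .$$ An almost gradient Ricci soliton $(\tilde g,\tilde\lambda,\tilde\phi)$ on $\tilde M$ consists of smooth functions $\tilde\phi,\tilde\lambda$ on $\tilde M$ with $H^{\tilde\phi}+\tilde S+\tilde\lambda\tilde g=0$, where $H^{\tilde\phi}$ is the Hessian of $\tilde\phi$ with respect to $\tilde g$ and $\tilde S$ is the Ricci tensor of $\tilde g$. $M$ is identified with a slice $M\times\{t_0\}$, and $\tilde\phi|_M$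 is the restriction to this slice; $H^\phi$ is its Hessian on $(M,g)$. Null convergence condition: $\tilde S(v,v)\ge 0$ for every null tangent vector $v$ of $\tilde M$. *)

theory Defs
  imports "HOL-Analysis.Analysis"
begin

section \<open>Smooth manifolds\<close>

primrec Ck_on :: "nat \<Rightarrow> 'a::euclidean_space set \<Rightarrow> ('a \<Rightarrow> 'b::real_normed_vector) \<Rightarrow> bool" where
  "Ck_on 0 S h \<longleftrightarrow> continuous_on S h"
| "Ck_on (Suc k) S h \<longleftrightarrow>
     (\<forall>x\<in>S. h differentiable (at x)) \<and>
     (\<forall>b\<in>Basis. Ck_on k S (\<lambda>x. frechet_derivative h (at x) b))"

text \<open>Intended for open \<open>S\<close> only.\<close>

definition smooth_on :: "'a::euclidean_space set \<Rightarrow> ('a \<Rightarrow> 'b::real_normed_vector) \<Rightarrow> bool" where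
  "smooth_on S h \<longleftrightarrow> (\<forall>k. Ck_on k S h)"

text \<open>
  The underlying set of a manifold is a whole Hausdorff, second countable type \<open>'m\<close>, its model
  space is a Euclidean space \<open>'e\<close>, so that its dimension is \<open>DIM('e)\<close>.  A chart is a domain
  together with a coordinate map; an atlas is a family of charts indexed by a type \<open>'i\<close>.
\<close>

type_synonym ('m, 'e) chart = "'m set \<times> ('m \<Rightarrow> 'e)"
type_synonym ('i, 'm, 'e) atlas = "'i \<Rightarrow> ('m, 'e) chart"

definition in_chart :: "('m, 'e) chart \<Rightarrow> ('m \<Rightarrow> 'b) \<Rightarrow> 'e \<Rightarrow> 'b" where
  "in_chart C h x = h (inv_into (fst C) (snd C) x)"

definition smooth_atlas ::
    "('i, 'm::{second_countable_topology,t2_space}, 'e::euclidean_space) atlas \<Rightarrow> bool" where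
  "smooth_atlas c \<longleftrightarrow>
     (\<Union>i. fst (c i)) = UNIV \<and>
     (\<forall>i. open (fst (c i)) \<and> open (snd (c i) ` fst (c i)) \<and>
          homeomorphism (fst (c i)) (snd (c i) ` fst (c i))
            (snd (c i)) (inv_into (fst (c i)) (snd (c i)))) \<and>
     (\<forall>i j. smooth_on (snd (c i) ` (fst (c i) \<inter> fst (c j))) (in_chart (c i) (snd (c j))))"

definition smooth_fun :: "('i, 'm, 'e::euclidean_space) atlas \<Rightarrow> ('m \<Rightarrow> real) \<Rightarrow> bool" where
  "smooth_fun c h \<longleftrightarrow> (\<forall>i. smooth_on (snd (c i) ` fst (c i)) (in_chart (c i) h))"

text \<open>
  A covariant 2-tensor field is given by its local representatives: \<open>g i x u v\<close> is its value, in
  the \<open>i\<close>-th chart and at the point with coordinates \<open>x\<close>, on the two tangent vectors with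
  coordinates \<open>u\<close> and \<open>v\<close>.  The last clause of the following definition is the transformation law
  under a change of charts.
\<close>

type_synonym 'e form_field = "'e \<Rightarrow> 'e \<Rightarrow> 'e \<Rightarrow> real"
type_synonym ('i, 'e) tensor2 = "'i \<Rightarrow> 'e form_field"

definition riemannian_metric ::
    "('i, 'm, 'e::euclidean_space) atlas \<Rightarrow> ('i, 'e) tensor2 \<Rightarrow> bool" where
  "riemannian_metric c g \<longleftrightarrow>
     (\<forall>i. \<forall>x \<in> snd (c i) ` fst (c i).
        bilinear (g i x) \<and> (\<forall>u v. g i x u v = g i x v u) \<and> (\<forall>u. u \<noteq> 0 \<longrightarrow> g i x u u > 0)) \<and>
     (\<forall>i u v. smooth_on (snd (c i) ` fst (c i)) (\<lambda>x. g i x u v)) \<and>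
     (\<forall>i j. \<forall>p \<in> fst (c i) \<inter> fst (c j). \<forall>u v.
        let T = frechet_derivative (in_chart (c i) (snd (c j))) (at (snd (c i) p))
        in g i (snd (c i) p) u v = g j (snd (c j) p) (T u) (T v))"


section \<open>Curvature and Hessian in a chart\<close>

text \<open>
  Below, \<open>G\<close> is the local representative of a (semi-Riemannian) metric in some chart; vectors of the
  model space are regarded as vector fields with constant coordinates.  For a nondegenerate
  bilinear form \<open>B\<close>, \<open>sharp B\<close> raises the index of a linear form.
\<close>

definition sharp :: "('e::euclidean_space \<Rightarrow> 'e \<Rightarrow> real) \<Rightarrow> ('e \<Rightarrow> real) \<Rightarrow> 'e" where
  "sharp B \<omega> = (THE z. \<forall>w. B z w = \<omega> w)"

text \<open>The trace of the bilinear form \<open>H\<close> with respect to \<open>B\<close>, i.e. the trace of \<open>u \<mapsto> sharp B (H u)\<close>.\<close>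

definition trace_wrt ::
    "('e::euclidean_space \<Rightarrow> 'e \<Rightarrow> real) \<Rightarrow> ('e \<Rightarrow> 'e \<Rightarrow> real) \<Rightarrow> real" where
  "trace_wrt B H = (\<Sum>b\<in>Basis. sharp B (H b) \<bullet> b)"

text \<open>The Levi-Civita covariant derivative \<open>\<nabla>\<^sub>u v\<close>, by the Koszul formula.\<close>

definition christoffel :: "'e::euclidean_space form_field \<Rightarrow> 'e \<Rightarrow> 'e \<Rightarrow> 'e \<Rightarrow> 'e" where
  "christoffel G x u v = sharp (G x) (\<lambda>w.
     (frechet_derivative (\<lambda>y. G y v w) (at x) u
      + frechet_derivative (\<lambda>y. G y u w) (at x) v
      - frechet_derivative (\<lambda>y. G y u v) (at x) w) / 2)"

definition hessian :: "'e::euclidean_space form_field \<Rightarrow> ('e \<Rightarrow> real) \<Rightarrow> 'e form_field" where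
  "hessian G h x u v =
     frechet_derivative (\<lambda>y. frechet_derivative h (at y) v) (at x) u
     - frechet_derivative h (at x) (christoffel G x u v)"

definition laplacian :: "'e::euclidean_space form_field \<Rightarrow> ('e \<Rightarrow> real) \<Rightarrow> 'e \<Rightarrow> real" where
  "laplacian G h x = trace_wrt (G x) (hessian G h x)"

text \<open>\<open>R(u,v)w = \<nabla>\<^sub>u \<nabla>\<^sub>v w - \<nabla>\<^sub>v \<nabla>\<^sub>u w\<close> (constant coordinate fields commute); the Ricci tensor is
  the trace of \<open>u \<mapsto> R(u,v)w\<close>, so that it is positive on round spheres.\<close>

definition curvature :: "'e::euclidean_space form_field \<Rightarrow> 'e \<Rightarrow> 'e \<Rightarrow> 'e \<Rightarrow> 'e \<Rightarrow> 'e" where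
  "curvature G x u v w =
     frechet_derivative (\<lambda>y. christoffel G y v w) (at x) u
     - frechet_derivative (\<lambda>y. christoffel G y u w) (at x) v
     + christoffel G x u (christoffel G x v w)
     - christoffel G x v (christoffel G x u w)"

definition ricci :: "'e::euclidean_space form_field \<Rightarrow> 'e form_field" where
  "ricci G x v w = (\<Sum>b\<in>Basis. curvature G x b v w \<bullet> b)"

definition scalar_curvature :: "'e::euclidean_space form_field \<Rightarrow> 'e \<Rightarrow> real" where
  "scalar_curvature G x = trace_wrt (G x) (ricci G x)"

definition ricci_flat ::
    "('i, 'm, 'e::euclidean_space) atlas \<Rightarrow> ('i, 'e) tensor2 \<Rightarrow> bool" where
  "ricci_flat c g \<longleftrightarrow> (\<forall>i. \<forall>p \<in> fst (c i). \<forall>u v. ricci (g i) (snd (c i) p) u v = 0)"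

definition hessian_vanishes ::
    "('i, 'm, 'e::euclidean_space) atlas \<Rightarrow> ('i, 'e) tensor2 \<Rightarrow> ('m \<Rightarrow> real) \<Rightarrow> bool" where
  "hessian_vanishes c g h \<longleftrightarrow>
     (\<forall>i. \<forall>p \<in> fst (c i). \<forall>u v. hessian (g i) (in_chart (c i) h) (snd (c i) p) u v = 0)"


section \<open>Static spacetimes\<close>

text \<open>The product manifold \<open>M \<times> \<real>\<close>, whose charts are indexed by the charts of \<open>M\<close>, and the metric
  \<open>g - f\<^sup>2 dt\<^sup>2\<close> on it.\<close>

definition spacetime_atlas :: "('i, 'm, 'e) atlas \<Rightarrow> ('i, 'm \<times> real, 'e \<times> real) atlas" where
  "spacetime_atlas c i = (fst (c i) \<times> UNIV, map_prod (snd (c i)) id)"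

definition static_metric ::
    "('i, 'm, 'e) atlas \<Rightarrow> ('i, 'e) tensor2 \<Rightarrow> ('m \<Rightarrow> real) \<Rightarrow> ('i, 'e \<times> real) tensor2" where
  "static_metric c g f i = (\<lambda>(x, t) (u, a) (v, b).
     g i x u v - (in_chart (c i) f x)\<^sup>2 * (a * b))"

definition static_perfect_fluid ::
    "('i, 'm, 'e::euclidean_space) atlas \<Rightarrow> ('i, 'e) tensor2 \<Rightarrow> ('m \<Rightarrow> real) \<Rightarrow> ('m \<Rightarrow> real) \<Rightarrow> bool"
  where
  "static_perfect_fluid c g f \<rho> \<longleftrightarrow>
     smooth_fun c \<rho> \<and>
     (\<forall>i. \<forall>p \<in> fst (c i).
        let n = real DIM('e); x = snd (c i) p; r = scalar_curvature (g i) x;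
            \<Delta>f = laplacian (g i) (in_chart (c i) f) x
        in (\<forall>u v. f p * (ricci (g i) x u v - r / n * g i x u v)
                = hessian (g i) (in_chart (c i) f) x u v - \<Delta>f / n * g i x u v) \<and>
           \<Delta>f = ((n - 2) / (2 * (n - 1)) * r + n / (n - 1) * \<rho> p) * f p)"

definition almost_gradient_ricci_soliton ::
    "('i, 'm, 'e::euclidean_space) atlas \<Rightarrow> ('i, 'e) tensor2 \<Rightarrow> ('m \<Rightarrow> real) \<Rightarrow> ('m \<Rightarrow> real) \<Rightarrow> bool"
  where
  "almost_gradient_ricci_soliton c g lam \<phi> \<longleftrightarrow>
     smooth_fun c lam \<and> smooth_fun c \<phi> \<and>
     (\<forall>i. \<forall>p \<in> fst (c i). \<forall>u v. let x = snd (c i) p in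
        hessian (g i) (in_chart (c i) \<phi>) x u v + ricci (g i) x u v + lam p * g i x u v = 0)"

definition null_convergence_condition ::
    "('i, 'm, 'e::euclidean_space) atlas \<Rightarrow> ('i, 'e) tensor2 \<Rightarrow> bool" where
  "null_convergence_condition c g \<longleftrightarrow>
     (\<forall>i. \<forall>p \<in> fst (c i). \<forall>v. let x = snd (c i) p in
        v \<noteq> 0 \<and> g i x v v = 0 \<longrightarrow> ricci (g i) x v v \<ge> 0)"

end

theory Submission
  imports Defs
begin

text \<open>
  Write \<open>n\<close> for the dimension.  The Ricci tensor of \<open>g - f\<^sup>2 dt\<^sup>2\<close> is that of \<open>g\<close> minus the Hessian of \<open>f\<close>
  divided by \<open>f\<close> on spatial vectors, it is \<open>f\<close> times the Laplacian of \<open>f\<close> on \<open>\<partial>\<^sub>t\<close>, and its mixed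
  components vanish (lemma \<open>ricci_static\<close>).  If \<open>g\<close> is Ricci flat, the perfect fluid equation says that
  the Hessian of \<open>f\<close> is \<open>\<mu> g\<close> for a function \<open>\<mu>\<close>, so that everything depends on \<open>\<mu>\<close>.

  The theorem holds because \<open>\<mu>\<close> vanishes: the Ricci tensor of the spacetime is then zero, in particular
  on null vectors.  First, commuting covariant derivatives of the gradient of \<open>f\<close> gives
  \<open>Ric(v, \<nabla>f) = - (n - 1) d\<mu>(v)\<close> (lemma \<open>ricci_grad\<close>), so that \<open>\<mu>\<close> is locally constant.  Secondly, the
  soliton equation has more components than unknowns.  Its mixed components show that the potential
  is, near any point, \<open>\<phi>(x, t) = \<phi>(x, t0) + K(t) f(x)\<close>; since the first summand has vanishing Hessian,
  the spatial components express the soliton function by \<open>f\<close>, \<open>K\<close> and \<open>\<mu>\<close>.  Inserting this into the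
  time-time component and differentiating in space gives \<open>\<mu> d\<phi> = 0\<close> on each slice, and the
  alternative \<open>d\<phi> = 0\<close> leads back to \<open>\<mu> = 0\<close> (lemma \<open>factor_zero\<close>).

  All computations take place in a single chart, where the metric is a family of bilinear forms on a
  Euclidean space.  The Christoffel symbols and gradients are defined there by solving linear
  equations, which is why their differentiability rests on the lemma \<open>differentiable_linear_solve\<close>.
\<close>

section \<open>Derivatives of families of linear maps and symmetry of second derivatives\<close>

abbreviation D :: "('a::real_normed_vector \<Rightarrow> 'b::real_normed_vector) \<Rightarrow> 'a \<Rightarrow> 'a \<Rightarrow> 'b"
  where "D h x \<equiv> frechet_derivative h (at x)"

lemma D_has_derivative: "h differentiable (at x) \<Longrightarrow> (h has_derivative D h x) (at x)"
  by (simp add: frechet_derivative_works)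

lemma D_eqI: "(h has_derivative h') (at x) \<Longrightarrow> D h x = h'"
  by (metis frechet_derivative_at)

lemma D_cong:
  assumes "open S" "x \<in> S" "\<And>y. y \<in> S \<Longrightarrow> h y = k y"
  shows "D h x = D k x"
proof -
  have "(h has_derivative l) (at x) \<longleftrightarrow> (k has_derivative l) (at x)" for l
    using has_derivative_transform_within_open[of _ _ x UNIV S] assms by metis
  then show ?thesis by (simp add: frechet_derivative_def)
qed

lemma linear_D: "h differentiable (at x) \<Longrightarrow> linear (D h x)"
  by (rule linear_frechet_derivative)

lemma linear_basis_expansion:
  fixes L :: "'e::euclidean_space \<Rightarrow> 'b::real_vector"
  assumes "linear L"
  shows "L v = (\<Sum>b\<in>Basis. (v \<bullet> b) *\<^sub>R L b)"
proof -
  interpret linear L by fact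
  have "L v = L (\<Sum>b\<in>Basis. (v \<bullet> b) *\<^sub>R b)" by (simp add: euclidean_representation)
  also have "\<dots> = (\<Sum>b\<in>Basis. (v \<bullet> b) *\<^sub>R L b)" by (simp add: sum scaleR)
  finally show ?thesis .
qed

lemma linear_D_family:
  fixes L :: "'a::real_normed_vector \<Rightarrow> 'e::euclidean_space \<Rightarrow> 'b::real_normed_vector"
  assumes S: "open S" "x \<in> S"
    and lin: "\<And>y. y \<in> S \<Longrightarrow> linear (L y)"
    and diff: "\<And>v. (\<lambda>y. L y v) differentiable (at x)"
  shows "linear (\<lambda>v. D (\<lambda>y. L y v) x h)"
proof (rule linearI)
  fix v w
  have "((\<lambda>y. L y v + L y w) has_derivative (\<lambda>h. D (\<lambda>y. L y v) x h + D (\<lambda>y. L y w) x h)) (at x)"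
    by (intro has_derivative_add D_has_derivative diff)
  from D_eqI[OF this] show "D (\<lambda>y. L y (v + w)) x h = D (\<lambda>y. L y v) x h + D (\<lambda>y. L y w) x h"
    using D_cong[OF S, of "\<lambda>y. L y (v + w)" "\<lambda>y. L y v + L y w"] lin by (simp add: linear_add)
next
  fix r v
  have "((\<lambda>y. r *\<^sub>R L y v) has_derivative (\<lambda>h. r *\<^sub>R D (\<lambda>y. L y v) x h)) (at x)"
    by (intro has_derivative_scaleR_right D_has_derivative diff)
  from D_eqI[OF this] show "D (\<lambda>y. L y (r *\<^sub>R v)) x h = r *\<^sub>R D (\<lambda>y. L y v) x h"
    using D_cong[OF S, of "\<lambda>y. L y (r *\<^sub>R v)" "\<lambda>y. r *\<^sub>R L y v"] lin by (simp add: linear_scale)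
qed

text \<open>
  The product rule for evaluating a family of linear maps along a moving vector.  Metrics,
  differentials and Christoffel symbols are only known through their values on constant vectors,
  and this rule extends their derivatives to vector fields.
\<close>

lemma has_derivative_linear_family:
  fixes L :: "'a::real_normed_vector \<Rightarrow> 'e::euclidean_space \<Rightarrow> 'b::real_normed_vector"
  assumes S: "open S" "x \<in> S"
    and lin: "\<And>y. y \<in> S \<Longrightarrow> linear (L y)"
    and diff: "\<And>v. (\<lambda>y. L y v) differentiable (at x)"
    and Y: "(Y has_derivative Y') (at x)"
  shows "((\<lambda>y. L y (Y y)) has_derivative (\<lambda>h. D (\<lambda>y. L y (Y x)) x h + L x (Y' h))) (at x)"
proof -
  have "((\<lambda>y. \<Sum>b\<in>Basis. (Y y \<bullet> b) *\<^sub>R L y b) has_derivative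
      (\<lambda>h. \<Sum>b\<in>Basis. (Y x \<bullet> b) *\<^sub>R D (\<lambda>y. L y b) x h + (Y' h \<bullet> b) *\<^sub>R L x b)) (at x)"
    by (intro has_derivative_sum has_derivative_scaleR D_has_derivative diff
        has_derivative_inner_left Y)
  moreover have "(\<Sum>b\<in>Basis. (Y x \<bullet> b) *\<^sub>R D (\<lambda>y. L y b) x h + (Y' h \<bullet> b) *\<^sub>R L x b)
      = D (\<lambda>y. L y (Y x)) x h + L x (Y' h)" for h
    unfolding sum.distrib
    using linear_basis_expansion[OF linear_D_family[OF S lin diff], of "Y x" h]
      linear_basis_expansion[OF lin[OF S(2)], of "Y' h"] by simp
  ultimately have "((\<lambda>y. \<Sum>b\<in>Basis. (Y y \<bullet> b) *\<^sub>R L y b) has_derivative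
      (\<lambda>h. D (\<lambda>y. L y (Y x)) x h + L x (Y' h))) (at x)" by simp
  then show ?thesis
    by (rule has_derivative_transform_within_open[OF _ S])
       (metis lin linear_basis_expansion)
qed

lemma smooth_on_differentiable:
  assumes "smooth_on S h" "x \<in> S" shows "h differentiable (at x)"
proof -
  have "Ck_on (Suc 0) S h" using assms(1) unfolding smooth_on_def by blast
  then show ?thesis using assms(2) by simp
qed

lemma smooth_on_D:
  assumes "smooth_on S h" "b \<in> Basis" shows "smooth_on S (\<lambda>x. D h x b)"
  unfolding smooth_on_def
proof
  fix k
  have "Ck_on (Suc k) S h" using assms(1) unfolding smooth_on_def by blast
  then show "Ck_on k S (\<lambda>x. D h x b)" using assms(2) by simp
qed

lemma smooth_on_D_differentiable:
  assumes h: "smooth_on S h" and S: "open S" "x \<in> S"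
  shows "(\<lambda>y. D h y v) differentiable (at x)"
proof -
  have "(\<lambda>y. \<Sum>b\<in>Basis. (v \<bullet> b) *\<^sub>R D h y b) differentiable (at x)"
    by (intro differentiable_sum differentiable_scaleR differentiable_const ballI finite_Basis
        smooth_on_differentiable[OF smooth_on_D[OF h]] S)
  then have "((\<lambda>y. \<Sum>b\<in>Basis. (v \<bullet> b) *\<^sub>R D h y b) has_derivative
      D (\<lambda>y. \<Sum>b\<in>Basis. (v \<bullet> b) *\<^sub>R D h y b) x) (at x)" by (rule D_has_derivative)
  then have "((\<lambda>y. D h y v) has_derivative
      D (\<lambda>y. \<Sum>b\<in>Basis. (v \<bullet> b) *\<^sub>R D h y b) x) (at x)"
    by (rule has_derivative_transform_within_open[OF _ S])
       (metis linear_basis_expansion linear_D smooth_on_differentiable[OF h])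
  then show ?thesis by (rule differentiableI)
qed

text \<open>
  The second difference of \<open>h\<close> along \<open>u\<close> and \<open>v\<close> is symmetric in the two vectors.  By the mean
  value theorem in the direction \<open>v\<close> it is \<open>s\<close> times an increment of \<open>D h v\<close> along \<open>s u\<close>, so that
  its quotient by \<open>s\<^sup>2\<close> computes the iterated derivative.  Only differentiability of
  \<open>D h v\<close> at the point \<open>x\<close> is assumed, which is what is at hand for the gradient field to which the
  symmetry is applied below.
\<close>

lemma second_difference_quotient:
  fixes h :: "'a::real_normed_vector \<Rightarrow> real"
  assumes S: "open S" "x \<in> S"
    and diff: "\<And>y. y \<in> S \<Longrightarrow> h differentiable (at y)"
    and diff2: "(\<lambda>y. D h y v) differentiable (at x)"
  shows "((\<lambda>s. (h (x + s *\<^sub>R u + s *\<^sub>R v) - h (x + s *\<^sub>R u) - h (x + s *\<^sub>R v) + h x) / s\<^sup>2)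
           \<longlongrightarrow> D (\<lambda>y. D h y v) x u) (at_right 0)"
proof (rule tendstoI)
  fix \<epsilon> :: real assume \<epsilon>: "0 < \<epsilon>"
  define H where "H = D (\<lambda>y. D h y v) x"
  define N where "N = norm u + norm v + 1"
  have N: "N > 0" unfolding N_def by (simp add: add_nonneg_pos)
  interpret H: linear H unfolding H_def by (rule linear_D[OF diff2])
  obtain \<delta>1 where \<delta>1: "\<delta>1 > 0" "ball x \<delta>1 \<subseteq> S" using S openE by blast
  define e where "e = \<epsilon> / (4 * N)"
  have e: "e > 0" using \<epsilon> N by (simp add: e_def)
  from D_has_derivative[OF diff2] e obtain \<delta>2 where \<delta>2: "\<delta>2 > 0"
    "\<And>y. norm (y - x) < \<delta>2 \<Longrightarrow> norm (D h y v - D h x v - H (y - x)) \<le> e * norm (y - x)"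
    unfolding has_derivative_at_alt H_def by blast
  define d where "d = min \<delta>1 \<delta>2 / N"
  have d: "d > 0" using \<delta>1 \<delta>2 N by (simp add: d_def)
  have est: "dist ((h (x + s *\<^sub>R u + s *\<^sub>R v) - h (x + s *\<^sub>R u) - h (x + s *\<^sub>R v) + h x) / s\<^sup>2) (H u) < \<epsilon>"
    if s: "0 < s" "s < d" for s
  proof -
    have small: "norm (a *\<^sub>R u + b *\<^sub>R v) \<le> s * N" if "0 \<le> a" "a \<le> s" "0 \<le> b" "b \<le> s" for a b
    proof -
      have "norm (a *\<^sub>R u + b *\<^sub>R v) \<le> a * norm u + b * norm v"
        using norm_triangle_ineq[of "a *\<^sub>R u" "b *\<^sub>R v"] that by simp
      also have "\<dots> \<le> s * norm u + s * norm v"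
        using that by (intro add_mono mult_right_mono) auto
      also have "\<dots> \<le> s * N" unfolding N_def using s by (simp add: algebra_simps)
      finally show ?thesis .
    qed
    have sN: "s * N < \<delta>1" "s * N < \<delta>2"
      using s N by (auto simp: d_def field_simps)
    have inS: "x + a *\<^sub>R u + b *\<^sub>R v \<in> S" if "0 \<le> a" "a \<le> s" "0 \<le> b" "b \<le> s" for a b
    proof -
      have "dist x (x + a *\<^sub>R u + b *\<^sub>R v) < \<delta>1"
        using small[OF that] sN(1) by (metis add.assoc add_diff_cancel_left' dist_commute dist_norm le_less_trans)
      then show ?thesis using \<delta>1(2) by auto
    qed
    have approx: "\<bar>D h (x + a *\<^sub>R u + b *\<^sub>R v) v - D h x v - H (a *\<^sub>R u + b *\<^sub>R v)\<bar> \<le> e * (s * N)"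
      if "0 \<le> a" "a \<le> s" "0 \<le> b" "b \<le> s" for a b
    proof -
      have "norm (D h (x + a *\<^sub>R u + b *\<^sub>R v) v - D h x v - H (x + a *\<^sub>R u + b *\<^sub>R v - x))
          \<le> e * norm (x + a *\<^sub>R u + b *\<^sub>R v - x)"
        using small[OF that] sN(2) by (intro \<delta>2(2)) (simp add: add.assoc)
      also have "\<dots> \<le> e * (s * N)" using small[OF that] e by (simp add: add.assoc)
      finally show ?thesis by (simp add: add.assoc)
    qed
    define \<xi> where "\<xi> \<theta> = h (x + s *\<^sub>R u + \<theta> *\<^sub>R v) - h (x + 0 *\<^sub>R u + \<theta> *\<^sub>R v)" for \<theta>
    have lineder: "((\<lambda>\<theta>. h (x + a *\<^sub>R u + \<theta> *\<^sub>R v)) has_real_derivative D h (x + a *\<^sub>R u + \<theta> *\<^sub>R v) v) (at \<theta>)"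
      if "0 \<le> a" "a \<le> s" "0 \<le> \<theta>" "\<theta> \<le> s" for a \<theta>
    proof -
      have hd: "(h has_derivative D h (x + a *\<^sub>R u + \<theta> *\<^sub>R v)) (at (x + a *\<^sub>R u + \<theta> *\<^sub>R v))"
        by (rule D_has_derivative[OF diff[OF inS[OF that]]])
      have "((\<lambda>\<theta>. x + a *\<^sub>R u + \<theta> *\<^sub>R v) has_derivative (\<lambda>k. k *\<^sub>R v)) (at \<theta>)"
        by (auto intro!: derivative_eq_intros)
      from has_derivative_compose[OF this hd]
      have "((\<lambda>\<theta>. h (x + a *\<^sub>R u + \<theta> *\<^sub>R v)) has_derivative
          (\<lambda>k. D h (x + a *\<^sub>R u + \<theta> *\<^sub>R v) (k *\<^sub>R v))) (at \<theta>)" .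
      moreover have "(\<lambda>k. D h (x + a *\<^sub>R u + \<theta> *\<^sub>R v) (k *\<^sub>R v)) = (*) (D h (x + a *\<^sub>R u + \<theta> *\<^sub>R v) v)"
        using linear_scale[OF linear_D[OF diff[OF inS[OF that]]]] by (auto simp: mult.commute)
      ultimately show ?thesis unfolding has_field_derivative_def by simp
    qed
    have "\<exists>\<theta>. 0 < \<theta> \<and> \<theta> < s \<and> \<xi> s - \<xi> 0 = (s - 0) * (D h (x + s *\<^sub>R u + \<theta> *\<^sub>R v) v - D h (x + 0 *\<^sub>R u + \<theta> *\<^sub>R v) v)"
      unfolding \<xi>_def using s by (intro MVT2 DERIV_diff lineder) auto
    then obtain \<theta> where \<theta>: "0 < \<theta>" "\<theta> < s" and
      mv: "\<xi> s - \<xi> 0 = s * (D h (x + s *\<^sub>R u + \<theta> *\<^sub>R v) v - D h (x + 0 *\<^sub>R u + \<theta> *\<^sub>R v) v)" by auto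
    have "\<bar>D h (x + s *\<^sub>R u + \<theta> *\<^sub>R v) v - D h x v - H (s *\<^sub>R u + \<theta> *\<^sub>R v)\<bar> \<le> e * (s * N)"
      using s \<theta> by (intro approx) auto
    moreover have "\<bar>D h (x + 0 *\<^sub>R u + \<theta> *\<^sub>R v) v - D h x v - H (0 *\<^sub>R u + \<theta> *\<^sub>R v)\<bar> \<le> e * (s * N)"
      using s \<theta> by (intro approx) auto
    moreover have "H (s *\<^sub>R u + \<theta> *\<^sub>R v) = s * H u + H (0 *\<^sub>R u + \<theta> *\<^sub>R v)"
      by (simp add: H.add H.scale)
    ultimately have "\<bar>(D h (x + s *\<^sub>R u + \<theta> *\<^sub>R v) v - D h (x + 0 *\<^sub>R u + \<theta> *\<^sub>R v) v) - s * H u\<bar> \<le> 2 * (e * (s * N))"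
      by linarith
    also have "\<dots> = s * (\<epsilon> / 2)" using N by (simp add: e_def)
    finally have main: "\<bar>(D h (x + s *\<^sub>R u + \<theta> *\<^sub>R v) v - D h (x + 0 *\<^sub>R u + \<theta> *\<^sub>R v) v) - s * H u\<bar> \<le> s * (\<epsilon> / 2)" .
    have quot: "(h (x + s *\<^sub>R u + s *\<^sub>R v) - h (x + s *\<^sub>R u) - h (x + s *\<^sub>R v) + h x) / s\<^sup>2 - H u
        = ((D h (x + s *\<^sub>R u + \<theta> *\<^sub>R v) v - D h (x + 0 *\<^sub>R u + \<theta> *\<^sub>R v) v) - s * H u) / s"
    proof -
      have "h (x + s *\<^sub>R u + s *\<^sub>R v) - h (x + s *\<^sub>R u) - h (x + s *\<^sub>R v) + h x
          = s * (D h (x + s *\<^sub>R u + \<theta> *\<^sub>R v) v - D h (x + 0 *\<^sub>R u + \<theta> *\<^sub>R v) v)"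
        using mv unfolding \<xi>_def by simp
      then show ?thesis using s by (simp only: power2_eq_square) (simp add: diff_divide_distrib)
    qed
    have "\<bar>(h (x + s *\<^sub>R u + s *\<^sub>R v) - h (x + s *\<^sub>R u) - h (x + s *\<^sub>R v) + h x) / s\<^sup>2 - H u\<bar> \<le> \<epsilon> / 2"
      unfolding quot using main s by (simp add: abs_divide field_simps)
    then show ?thesis using \<epsilon> by (simp add: dist_real_def)
  qed
  show "\<forall>\<^sub>F s in at_right 0. dist ((h (x + s *\<^sub>R u + s *\<^sub>R v) - h (x + s *\<^sub>R u) - h (x + s *\<^sub>R v) + h x) / s\<^sup>2)
      (D (\<lambda>y. D h y v) x u) < \<epsilon>"
    unfolding eventually_at_right_field H_def[symmetric] using d est by blast
qed

lemma symmetric_second_derivative: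
  fixes h :: "'a::real_normed_vector \<Rightarrow> real"
  assumes "open S" "x \<in> S"
    and "\<And>y. y \<in> S \<Longrightarrow> h differentiable (at y)"
    and "\<And>v. (\<lambda>y. D h y v) differentiable (at x)"
  shows "D (\<lambda>y. D h y v) x u = D (\<lambda>y. D h y u) x v"
proof (rule tendsto_unique)
  let ?q = "\<lambda>s. (h (x + s *\<^sub>R u + s *\<^sub>R v) - h (x + s *\<^sub>R u) - h (x + s *\<^sub>R v) + h x) / s\<^sup>2"
  show "(?q \<longlongrightarrow> D (\<lambda>y. D h y v) x u) (at_right 0)"
    by (rule second_difference_quotient[OF assms])
  have "(\<lambda>s. (h (x + s *\<^sub>R v + s *\<^sub>R u) - h (x + s *\<^sub>R v) - h (x + s *\<^sub>R u) + h x) / s\<^sup>2) = ?q"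
    by (auto simp: algebra_simps)
  with second_difference_quotient[OF assms, where u=v and v=u]
  show "(?q \<longlongrightarrow> D (\<lambda>y. D h y u) x v) (at_right 0)" by simp
qed simp

lemma symmetric_second_derivative_euclidean:
  fixes h :: "'a::real_normed_vector \<Rightarrow> 'b::euclidean_space"
  assumes S: "open S" "x \<in> S"
    and diff: "\<And>y. y \<in> S \<Longrightarrow> h differentiable (at y)"
    and diff2: "\<And>v. (\<lambda>y. D h y v) differentiable (at x)"
  shows "D (\<lambda>y. D h y v) x u = D (\<lambda>y. D h y u) x v"
proof (rule euclidean_eqI)
  fix b :: 'b assume "b \<in> Basis"
  have 1: "D (\<lambda>y. h y \<bullet> b) y w = D h y w \<bullet> b" if "y \<in> S" for y w
    using D_eqI[OF has_derivative_inner_left[OF D_has_derivative[OF diff[OF that]]]] by metis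
  have 2: "((\<lambda>y. D (\<lambda>y. h y \<bullet> b) y w) has_derivative (\<lambda>k. D (\<lambda>y. D h y w) x k \<bullet> b)) (at x)" for w
    by (rule has_derivative_transform_within_open[OF
          has_derivative_inner_left[OF D_has_derivative[OF diff2[of w]]] S]) (simp add: 1)
  have "D (\<lambda>y. D (\<lambda>y. h y \<bullet> b) y v) x u = D (\<lambda>y. D (\<lambda>y. h y \<bullet> b) y u) x v"
  proof (rule symmetric_second_derivative[OF S])
    show "(\<lambda>y. h y \<bullet> b) differentiable at y" if "y \<in> S" for y
      using has_derivative_inner_left[OF D_has_derivative[OF diff[OF that]]] differentiableI by blast
    show "(\<lambda>y. D (\<lambda>y. h y \<bullet> b) y w) differentiable at x" for w
      using 2 differentiableI by blast
  qed
  then show "D (\<lambda>y. D h y v) x u \<bullet> b = D (\<lambda>y. D h y u) x v \<bullet> b"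
    using D_eqI[OF 2, of v] D_eqI[OF 2, of u] by simp
qed

section \<open>Raising indices\<close>

lemma bilinear_linear_right: "bilinear B \<Longrightarrow> linear (B u)" by (simp add: bilinear_def)

lemma sharp_eqI:
  assumes B: "bilinear B" and nondeg: "\<And>u. (\<And>w. B u w = 0) \<Longrightarrow> u = 0"
    and z: "\<And>w. B z w = \<omega> w"
  shows "sharp B \<omega> = z"
  unfolding sharp_def
proof (rule the_equality)
  show "\<forall>w. B z w = \<omega> w" using z by blast
next
  fix z' assume "\<forall>w. B z' w = \<omega> w"
  then have "B (z' - z) w = 0" for w using z by (simp add: bilinear_lsub[OF B])
  then show "z' = z" using nondeg[of "z' - z"] by simp
qed

text \<open>
  The matrix of a bilinear form with respect to the Euclidean inner product: \<open>sharp\<close> solves the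
  linear equation with this operator.
\<close>

definition bilinear_operator :: "('e::euclidean_space \<Rightarrow> 'e \<Rightarrow> real) \<Rightarrow> 'e \<Rightarrow> 'e" where
  "bilinear_operator B z = (\<Sum>b\<in>Basis. B z b *\<^sub>R b)"

lemma bilinear_operator_inner_Basis: "b \<in> Basis \<Longrightarrow> bilinear_operator B z \<bullet> b = B z b"
  by (simp add: bilinear_operator_def inner_sum_left inner_Basis if_distrib cong: if_cong)

lemma bilinear_operator_inner:
  assumes "bilinear B" shows "bilinear_operator B z \<bullet> w = B z w"
  using linear_basis_expansion[OF bilinear_linear_right[OF assms], of z w]
  by (subst euclidean_inner) (simp add: bilinear_operator_inner_Basis mult.commute)

lemma linear_bilinear_operator: "bilinear B \<Longrightarrow> linear (bilinear_operator B)"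
  by (rule linearI)
    (simp_all add: bilinear_operator_def bilinear_ladd bilinear_lmul scaleR_add_left sum.distrib
      scaleR_sum_right)

lemma inj_bilinear_operator:
  assumes B: "bilinear B" and nondeg: "\<And>u. (\<And>w. B u w = 0) \<Longrightarrow> u = 0"
  shows "inj (bilinear_operator B)"
  unfolding linear_injective_0[OF linear_bilinear_operator[OF B]]
  using nondeg bilinear_operator_inner[OF B] by (metis inner_zero_left)

lemma sharp_inner:
  fixes B :: "'e::euclidean_space \<Rightarrow> 'e \<Rightarrow> real"
  assumes B: "bilinear B" and nondeg: "\<And>u. (\<And>w. B u w = 0) \<Longrightarrow> u = 0" and \<omega>: "linear \<omega>"
  shows "B (sharp B \<omega>) w = \<omega> w"
proof -
  have "surj (bilinear_operator B)"
    by (rule linear_injective_imp_surjective[OF linear_bilinear_operator[OF B]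
          inj_bilinear_operator[OF B nondeg]]) simp_all
  then obtain z where z: "bilinear_operator B z = (\<Sum>b\<in>Basis. \<omega> b *\<^sub>R b)" by (metis surjD)
  have "B z w = \<omega> w" for w
    unfolding bilinear_operator_inner[OF B, symmetric] z inner_sum_left
    using linear_basis_expansion[OF \<omega>, of w] by (simp add: inner_commute mult.commute)
  then show ?thesis using sharp_eqI[OF B nondeg] by metis
qed

text \<open>
  A product of a continuous factor and a differentiable one that vanishes at the point is
  differentiable there, although the first factor need not be.
\<close>

lemma has_derivative_scaleR_vanishing:
  fixes k :: "'a::real_normed_vector \<Rightarrow> real" and m :: "'a \<Rightarrow> 'b::real_normed_vector"
  assumes k: "isCont k x" and m: "(m has_derivative m') (at x)" and m0: "m x = 0"
  shows "((\<lambda>y. k y *\<^sub>R m y) has_derivative (\<lambda>h. k x *\<^sub>R m' h)) (at x)"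
proof -
  have "((\<lambda>y. (k y - k x) *\<^sub>R m y) has_derivative (\<lambda>h. 0)) (at x)"
    unfolding has_derivative_at_alt
  proof (intro conjI allI impI)
    fix e :: real assume e: "0 < e"
    obtain B where B: "B > 0" "\<And>h. norm (m' h) \<le> norm h * B"
      using bounded_linear.pos_bounded[OF has_derivative_bounded_linear[OF m]] by blast
    obtain d1 where d1: "d1 > 0" "\<And>y. norm (y - x) < d1 \<Longrightarrow> norm (m y - m x - m' (y - x)) \<le> 1 * norm (y - x)"
      using m zero_less_one unfolding has_derivative_at_alt by blast
    have "e / (B + 1) > 0" using e B by simp
    with k obtain d2 where d2: "d2 > 0" "\<And>y. dist y x < d2 \<Longrightarrow> dist (k y) (k x) < e / (B + 1)"
      unfolding continuous_at_eps_delta by blast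
    have "norm ((k y - k x) *\<^sub>R m y - (k x - k x) *\<^sub>R m x - 0) \<le> e * norm (y - x)"
      if "norm (y - x) < min d1 d2" for y
    proof -
      have "norm (m y) \<le> norm (m y - m x - m' (y - x)) + norm (m' (y - x))"
        using norm_triangle_ineq[of "m y - m x - m' (y - x)" "m' (y - x)"] m0 by simp
      also have "\<dots> \<le> (B + 1) * norm (y - x)"
        using d1(2)[of y] B(2)[of "y - x"] that by (simp add: algebra_simps)
      finally have 1: "norm (m y) \<le> (B + 1) * norm (y - x)" .
      have "\<bar>k y - k x\<bar> \<le> e / (B + 1)"
        using d2(2)[of y] that by (simp add: dist_norm)
      then have "\<bar>k y - k x\<bar> * norm (m y) \<le> e / (B + 1) * ((B + 1) * norm (y - x))"
        using 1 e B by (intro mult_mono) auto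
      also have "\<dots> = e * norm (y - x)" using B by simp
      finally show ?thesis by simp
    qed
    then show "\<exists>d>0. \<forall>y. norm (y - x) < d \<longrightarrow>
        norm ((k y - k x) *\<^sub>R m y - (k x - k x) *\<^sub>R m x - 0) \<le> e * norm (y - x)"
      using d1(1) d2(1) by (intro exI[of _ "min d1 d2"]) auto
  qed simp
  from has_derivative_add[OF has_derivative_scaleR_right[OF m, of "k x"] this]
  show ?thesis by (simp add: algebra_simps)
qed

text \<open>
  The solution of a linear equation depends differentiably on its data.  With \<open>J\<close> inverse to \<open>A x\<close>,
  the equation reads \<open>z y = J (W y) - J (E y)\<close> with the error \<open>E y = (A y - A x) (z y)\<close>.  This
  bootstraps the regularity of \<open>z\<close>: near \<open>x\<close> the operator \<open>A y - A x\<close> is small, which bounds \<open>z\<close>; then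
  \<open>E\<close> tends to \<open>0\<close>, so that \<open>z\<close> is continuous; and then \<open>E\<close> is differentiable as a product of a
  continuous factor and a vanishing differentiable one.
\<close>

lemma differentiable_linear_solve:
  fixes A :: "'a::real_normed_vector \<Rightarrow> 'e::euclidean_space \<Rightarrow> 'e"
  assumes S: "open S" "x \<in> S"
    and lin: "\<And>y. y \<in> S \<Longrightarrow> linear (A y)" and inj: "inj (A x)"
    and diff: "\<And>v. (\<lambda>y. A y v) differentiable (at x)"
    and W: "W differentiable (at x)"
    and z: "\<And>y. y \<in> S \<Longrightarrow> A y (z y) = W y"
  shows "z differentiable (at x)"
proof -
  obtain J where J: "linear J" "\<And>v. J (A x v) = v"
    using linear_injective_left_inverse[OF lin[OF S(2)] inj] by (metis comp_apply id_apply)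
  have blJ: "bounded_linear J" using J(1) by (rule linear_linear[THEN iffD2])
  obtain C where C: "C > 0" "\<And>v. norm (J v) \<le> norm v * C"
    using bounded_linear.pos_bounded[OF blJ] by blast
  define E where "E y = (\<Sum>b\<in>Basis. (z y \<bullet> b) *\<^sub>R (A y b - A x b))" for y
  have E: "E y = W y - A x (z y)" if "y \<in> S" for y
    using linear_basis_expansion[OF lin[OF that], of "z y"] z[OF that]
      linear_basis_expansion[OF lin[OF S(2)], of "z y"]
    by (simp add: E_def scaleR_diff_right sum_subtractf)
  have zJ: "z y = J (W y) - J (E y)" if "y \<in> S" for y
    using J E[OF that] by (simp add: linear_diff)
  define s where "s y = (\<Sum>b\<in>Basis. norm (A y b - A x b))" for y
  have contA: "isCont (\<lambda>y. A y b) x" for b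
    using diff differentiable_imp_continuous_within by blast
  have contW: "isCont W x" using W differentiable_imp_continuous_within by blast
  have "isCont s x" unfolding s_def by (intro continuous_intros contA)
  then have s0: "(s \<longlongrightarrow> 0) (at x)" unfolding isCont_def by (simp add: s_def)
  have Es: "norm (E y) \<le> norm (z y) * s y" for y
    unfolding E_def s_def sum_distrib_left
    by (intro sum_norm_le) (simp add: Basis_le_norm mult_right_mono)
  \<comment> \<open>The bound \<open>1 / (2 * C)\<close> lets half of the norm of \<open>z y\<close> absorb the error term.\<close>
  have ev_s: "\<forall>\<^sub>F y in at x. s y < 1 / (2 * C)"
    using order_tendstoD(2)[OF s0] C by simp
  have ev_W: "\<forall>\<^sub>F y in at x. norm (W y) < norm (W x) + 1"
    using order_tendstoD(2)[OF tendsto_norm[OF contW[unfolded isCont_def]], of "norm (W x) + 1"] by simp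
  have ev_S: "\<forall>\<^sub>F y in at x. y \<in> S" using S by (rule eventually_at_in_open')
  have ev_E: "\<forall>\<^sub>F y in at x. norm (E y) \<le> (2 * C * (norm (W x) + 1)) * s y"
    using ev_s ev_W ev_S
  proof eventually_elim
    case (elim y)
    have s_pos: "s y \<ge> 0" unfolding s_def by (intro sum_nonneg) auto
    have "norm (z y) \<le> norm (J (W y)) + norm (J (E y))"
      unfolding zJ[OF elim(3)] by (rule norm_triangle_ineq4)
    also have "\<dots> \<le> norm (W y) * C + norm (E y) * C"
      by (intro add_mono C)
    also have "\<dots> \<le> norm (W y) * C + norm (z y) * (1 / (2 * C)) * C"
    proof -
      have "norm (z y) * s y \<le> norm (z y) * (1 / (2 * C))"
        using elim(1) by (intro mult_left_mono) auto
      then have "norm (E y) \<le> norm (z y) * (1 / (2 * C))" using Es[of y] by linarith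
      then show ?thesis using C by (intro add_left_mono mult_right_mono) auto
    qed
    also have "\<dots> = norm (W y) * C + norm (z y) / 2" using C by simp
    finally have "norm (z y) \<le> 2 * C * norm (W y)" by (simp add: algebra_simps)
    also have "\<dots> \<le> 2 * C * (norm (W x) + 1)" using elim(2) C by simp
    finally have "norm (z y) * s y \<le> (2 * C * (norm (W x) + 1)) * s y"
      using s_pos by (rule mult_right_mono)
    then show ?case using Es[of y] by linarith
  qed
  have "((\<lambda>y. (2 * C * (norm (W x) + 1)) * s y) \<longlongrightarrow> 0) (at x)"
    using tendsto_mult_right_zero[OF s0] .
  then have "(E \<longlongrightarrow> 0) (at x)" by (rule Lim_null_comparison[OF ev_E])
  then have "((\<lambda>y. J (W y) - J (E y)) \<longlongrightarrow> J (W x) - J 0) (at x)"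
    using contW[unfolded isCont_def] by (intro tendsto_diff bounded_linear.tendsto[OF blJ])
  then have "(z \<longlongrightarrow> J (W x) - J 0) (at x)"
    by (rule Lim_transform_eventually) (use ev_S in \<open>auto elim: eventually_mono simp: zJ\<close>)
  moreover have "E x = 0" unfolding E_def by simp
  ultimately have contz: "isCont z x" unfolding isCont_def using zJ[OF S(2)] by simp
  have "(E has_derivative (\<lambda>h. \<Sum>b\<in>Basis. (z x \<bullet> b) *\<^sub>R (D (\<lambda>y. A y b) x h - 0))) (at x)"
    unfolding E_def
    by (intro has_derivative_sum has_derivative_scaleR_vanishing has_derivative_diff
        D_has_derivative diff has_derivative_const continuous_intros contz) simp
  then have "((\<lambda>y. J (W y) - J (E y)) has_derivative
     (\<lambda>h. J (D W x h) - J (\<Sum>b\<in>Basis. (z x \<bullet> b) *\<^sub>R (D (\<lambda>y. A y b) x h - 0)))) (at x)"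
    by (intro has_derivative_diff bounded_linear.has_derivative[OF blJ] D_has_derivative W)
  then have "(z has_derivative
     (\<lambda>h. J (D W x h) - J (\<Sum>b\<in>Basis. (z x \<bullet> b) *\<^sub>R (D (\<lambda>y. A y b) x h - 0)))) (at x)"
    by (rule has_derivative_transform_within_open[OF _ S]) (simp add: zJ)
  then show ?thesis by (rule differentiableI)
qed

lemma differentiable_sharp:
  fixes B :: "'a::real_normed_vector \<Rightarrow> 'e::euclidean_space \<Rightarrow> 'e \<Rightarrow> real"
  assumes S: "open S" "x \<in> S"
    and B: "\<And>y. y \<in> S \<Longrightarrow> bilinear (B y)"
    and nondeg: "\<And>y u. y \<in> S \<Longrightarrow> (\<And>w. B y u w = 0) \<Longrightarrow> u = 0"
    and lin: "\<And>y. y \<in> S \<Longrightarrow> linear (\<omega> y)"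
    and diffB: "\<And>u v. (\<lambda>y. B y u v) differentiable (at x)"
    and diff: "\<And>v. (\<lambda>y. \<omega> y v) differentiable (at x)"
  shows "(\<lambda>y. sharp (B y) (\<omega> y)) differentiable (at x)"
proof (rule differentiable_linear_solve[OF S])
  show "linear (bilinear_operator (B y))" if "y \<in> S" for y
    using linear_bilinear_operator[OF B[OF that]] .
  show "inj (bilinear_operator (B x))" by (rule inj_bilinear_operator[OF B[OF S(2)] nondeg[OF S(2)]])
  show "(\<lambda>y. bilinear_operator (B y) v) differentiable (at x)" for v
    unfolding bilinear_operator_def
    by (intro differentiable_sum differentiable_scaleR diffB differentiable_const finite_Basis ballI)
  show "(\<lambda>y. \<Sum>b\<in>Basis. \<omega> y b *\<^sub>R b) differentiable (at x)"
    by (intro differentiable_sum differentiable_scaleR diff differentiable_const finite_Basis ballI)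
  show "bilinear_operator (B y) (sharp (B y) (\<omega> y)) = (\<Sum>b\<in>Basis. \<omega> y b *\<^sub>R b)" if "y \<in> S" for y
    unfolding bilinear_operator_def using sharp_inner[OF B[OF that] nondeg[OF that] lin[OF that]] by simp
qed

section \<open>Levi-Civita connection and gradients in a chart\<close>

locale riemannian_form =
  fixes U :: "'e::euclidean_space set" and G :: "'e form_field"
  assumes open_U: "open U"
    and bilinear_G: "x \<in> U \<Longrightarrow> bilinear (G x)"
    and sym_G: "x \<in> U \<Longrightarrow> G x u v = G x v u"
    and pos_G: "x \<in> U \<Longrightarrow> u \<noteq> 0 \<Longrightarrow> G x u u > 0"
    and smooth_G: "smooth_on U (\<lambda>x. G x u v)"
begin

lemma G_left: "x \<in> U \<Longrightarrow> linear (\<lambda>u. G x u w)" and G_right: "x \<in> U \<Longrightarrow> linear (G x u)"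
  using bilinear_G by (auto simp: bilinear_def)

lemmas G_arith = linear_add[OF G_left] linear_add[OF G_right] linear_diff[OF G_left]
  linear_diff[OF G_right] linear_scale[OF G_left] linear_scale[OF G_right]
  linear_0[OF G_left] linear_0[OF G_right]

lemma G_nondegenerate: "x \<in> U \<Longrightarrow> (\<And>w. G x u w = 0) \<Longrightarrow> u = 0"
  using pos_G by (metis less_irrefl)

lemma G_eqI:
  assumes "x \<in> U" "\<And>w. G x u w = G x v w" shows "u = v"
  using G_nondegenerate[of x "u - v"] assms by (simp add: G_arith)

lemma differentiable_G: "x \<in> U \<Longrightarrow> (\<lambda>y. G y u v) differentiable (at x)"
  using smooth_on_differentiable[OF smooth_G] .

lemma differentiable_D_G: "x \<in> U \<Longrightarrow> (\<lambda>y. D (\<lambda>z. G z u v) y w) differentiable (at x)"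
  using smooth_on_D_differentiable[OF smooth_G open_U] .

lemma D_G_sym: "x \<in> U \<Longrightarrow> D (\<lambda>y. G y u v) x = D (\<lambda>y. G y v u) x"
  by (rule D_cong[OF open_U]) (simp_all add: sym_G)

lemma linear_koszul:
  assumes x: "x \<in> U"
  shows "linear (\<lambda>w. (D (\<lambda>y. G y v w) x u + D (\<lambda>y. G y u w) x v - D (\<lambda>y. G y u v) x w) / 2)"
proof -
  have "linear (\<lambda>w. (D (\<lambda>y. G y v w) x u + D (\<lambda>y. G y u w) x v - D (\<lambda>y. G y u v) x w))"
    by (intro linear_compose_add linear_compose_sub
        linear_D_family[OF open_U x G_right differentiable_G] linear_D differentiable_G x)
  from linear_compose_scale_right[OF this, of "1/2"] show ?thesis by simp
qed

lemma G_christoffel: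
  assumes x: "x \<in> U"
  shows "G x (christoffel G x u v) w
      = (D (\<lambda>y. G y v w) x u + D (\<lambda>y. G y u w) x v - D (\<lambda>y. G y u v) x w) / 2"
  unfolding christoffel_def
  by (rule sharp_inner[OF bilinear_G[OF x] G_nondegenerate[OF x] linear_koszul[OF x]])

lemma christoffel_sym: "x \<in> U \<Longrightarrow> christoffel G x u v = christoffel G x v u"
  by (rule G_eqI, assumption) (simp add: G_christoffel D_G_sym[of x u v])

lemma metric_compatible:
  assumes x: "x \<in> U"
  shows "D (\<lambda>y. G y v w) x u = G x (christoffel G x u v) w + G x v (christoffel G x u w)"
  unfolding sym_G[OF x, of v] G_christoffel[OF x] D_G_sym[OF x, of w v]
  by (simp add: D_G_sym[OF x, of w u] D_G_sym[OF x, of v u] field_simps)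

lemma linear_christoffel_right:
  assumes x: "x \<in> U"
  shows "linear (christoffel G x u)"
proof (rule linearI)
  note lin = linear_D_family[OF open_U x G_left differentiable_G[OF x]]
    linear_D[OF differentiable_G[OF x]] linear_D_family[OF open_U x G_right differentiable_G[OF x]]
  show "christoffel G x u (v + v') = christoffel G x u v + christoffel G x u v'" for v v'
    by (rule G_eqI[OF x])
      (simp add: G_christoffel[OF x] G_arith[OF x] lin[THEN linear_add] field_simps)
  show "christoffel G x u (r *\<^sub>R v) = r *\<^sub>R christoffel G x u v" for r v
    by (rule G_eqI[OF x])
      (simp add: G_christoffel[OF x] G_arith[OF x] lin[THEN linear_scale] algebra_simps)
qed

lemma linear_christoffel_left:
  assumes x: "x \<in> U"
  shows "linear (\<lambda>u. christoffel G x u v)"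
proof -
  have "(\<lambda>u. christoffel G x u v) = christoffel G x v"
    by (rule ext) (rule christoffel_sym[OF x])
  then show ?thesis using linear_christoffel_right[OF x] by simp
qed

lemmas christoffel_arith = linear_add[OF linear_christoffel_right] linear_add[OF linear_christoffel_left]
  linear_diff[OF linear_christoffel_right] linear_diff[OF linear_christoffel_left]
  linear_scale[OF linear_christoffel_right] linear_scale[OF linear_christoffel_left]
  linear_0[OF linear_christoffel_right] linear_0[OF linear_christoffel_left]

lemma differentiable_christoffel:
  assumes x: "x \<in> U"
  shows "(\<lambda>y. christoffel G y u v) differentiable (at x)"
  unfolding christoffel_def
proof (rule differentiable_sharp[OF open_U x bilinear_G G_nondegenerate linear_koszul])
  show "(\<lambda>y. (D (\<lambda>z. G z v w) y u + D (\<lambda>z. G z u w) y v - D (\<lambda>z. G z u v) y w) / 2)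
      differentiable (at x)" for w
    by (intro differentiable_divide differentiable_add differentiable_diff differentiable_D_G x
        differentiable_const) simp
qed (use x differentiable_G in auto)

text \<open>
  The Leibniz rule for the metric, with the derivatives of the fields completed to covariant
  derivatives.
\<close>

lemma has_derivative_G_fields:
  assumes x: "x \<in> U" and Y: "(Y has_derivative Y') (at x)" and Z: "(Z has_derivative Z') (at x)"
  shows "((\<lambda>y. G y (Y y) (Z y)) has_derivative
     (\<lambda>h. G x (Y' h + christoffel G x h (Y x)) (Z x) + G x (Y x) (Z' h + christoffel G x h (Z x)))) (at x)"
proof -
  have 1: "((\<lambda>y. G y v (Z y)) has_derivative (\<lambda>h. D (\<lambda>y. G y v (Z x)) x h + G x v (Z' h))) (at x)" for v
    by (rule has_derivative_linear_family[OF open_U x G_right differentiable_G[OF x] Z])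
  have "((\<lambda>y. G y (Y y) (Z y)) has_derivative
     (\<lambda>h. D (\<lambda>y. G y (Y x) (Z y)) x h + G x (Y' h) (Z x))) (at x)"
    by (rule has_derivative_linear_family[OF open_U x G_left differentiableI[OF 1] Y])
  then show ?thesis
    unfolding D_eqI[OF 1] by (simp add: metric_compatible[OF x] G_arith[OF x] algebra_simps)
qed

definition grad :: "('e \<Rightarrow> real) \<Rightarrow> 'e \<Rightarrow> 'e" where
  "grad h x = sharp (G x) (D h x)"

text \<open>
  Only two derivatives of \<open>h\<close> are used for the gradient, so that these facts also apply to functions
  that arise as restrictions to slices.
\<close>

context
  fixes h :: "'e \<Rightarrow> real"
  assumes differentiable_h: "\<And>x. x \<in> U \<Longrightarrow> h differentiable (at x)"
    and differentiable_D_h: "\<And>x v. x \<in> U \<Longrightarrow> (\<lambda>y. D h y v) differentiable (at x)"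
begin

lemma linear_D_h: "x \<in> U \<Longrightarrow> linear (D h x)"
  using linear_D[OF differentiable_h] .

lemma G_grad: "x \<in> U \<Longrightarrow> G x (grad h x) w = D h x w"
  unfolding grad_def by (rule sharp_inner[OF bilinear_G G_nondegenerate linear_D_h])

lemma differentiable_grad: "x \<in> U \<Longrightarrow> grad h differentiable (at x)"
  unfolding grad_def[abs_def]
  by (rule differentiable_sharp[OF open_U _ bilinear_G G_nondegenerate linear_D_h
        differentiable_G differentiable_D_h])

text \<open>
  The Hessian is the covariant derivative of the gradient: differentiate \<open>G (grad h) v = D h v\<close>.
\<close>

lemma G_nabla_grad:
  assumes x: "x \<in> U"
  shows "G x (D (grad h) x u + christoffel G x u (grad h x)) v = hessian G h x u v"
proof -
  have "((\<lambda>y. G y (grad h y) v) has_derivative (\<lambda>k.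
      G x (D (grad h) x k + christoffel G x k (grad h x)) v + G x (grad h x) (0 + christoffel G x k v))) (at x)"
    by (intro has_derivative_G_fields D_has_derivative differentiable_grad x has_derivative_const)
  from D_eqI[OF this] have "D (\<lambda>y. G y (grad h y) v) x u
    = G x (D (grad h) x u + christoffel G x u (grad h x)) v + D h x (christoffel G x u v)"
    by (simp add: G_grad[OF x])
  moreover have "D (\<lambda>y. G y (grad h y) v) x = D (\<lambda>y. D h y v) x"
    by (rule D_cong[OF open_U x]) (simp add: G_grad)
  ultimately show ?thesis by (simp add: hessian_def)
qed

lemma laplacian_eq:
  assumes x: "x \<in> U"
  shows "laplacian G h x = (\<Sum>b\<in>Basis. (D (grad h) x b + christoffel G x b (grad h x)) \<bullet> b)"
  unfolding laplacian_def trace_wrt_def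
  by (simp add: sharp_eqI[OF bilinear_G[OF x] G_nondegenerate[OF x] G_nabla_grad[OF x]])

lemma has_derivative_D_field:
  assumes x: "x \<in> U" and Y: "(Y has_derivative Y') (at x)"
  shows "((\<lambda>y. D h y (Y y)) has_derivative
     (\<lambda>k. hessian G h x k (Y x) + D h x (Y' k + christoffel G x k (Y x)))) (at x)"
  using has_derivative_linear_family[OF open_U x linear_D_h differentiable_D_h[OF x] Y]
  by (simp add: hessian_def linear_add[OF linear_D_h[OF x]])

context
  fixes \<mu> :: "'e \<Rightarrow> real"
  assumes hessian_eq: "\<And>x u v. x \<in> U \<Longrightarrow> hessian G h x u v = \<mu> x * G x u v"
begin

lemma nabla_grad:
  assumes x: "x \<in> U"
  shows "D (grad h) x u + christoffel G x u (grad h x) = \<mu> x *\<^sub>R u"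
  by (rule G_eqI[OF x]) (simp add: G_nabla_grad[OF x] hessian_eq[OF x] linear_scale[OF G_left[OF x]])

lemma laplacian_factor: "x \<in> U \<Longrightarrow> laplacian G h x = real DIM('e) * \<mu> x"
  by (simp add: laplacian_eq nabla_grad)

context
  assumes smooth_h: "smooth_on U h"
begin

text \<open>
  The factor is a quotient of a component of the Hessian by one of the metric.
\<close>

lemma differentiable_factor:
  assumes x: "x \<in> U"
  shows "\<mu> differentiable (at x)"
proof -
  obtain e :: 'e where e: "e \<in> Basis" using nonempty_Basis by blast
  then have e0: "e \<noteq> 0" by auto
  have "(\<lambda>y. D (\<lambda>z. D h z e) y e - D h y (christoffel G y e e)) differentiable (at x)"
    using smooth_on_differentiable[OF smooth_on_D[OF smooth_on_D[OF smooth_h e] e] x]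
      differentiableI[OF has_derivative_D_field[OF x D_has_derivative[OF differentiable_christoffel[OF x]]]]
    by (rule differentiable_diff)
  then have "(\<lambda>y. hessian G h y e e / G y e e) differentiable (at x)"
    unfolding hessian_def using pos_G[OF x e0] by (intro differentiable_divide differentiable_G x) auto
  from D_has_derivative[OF this]
  have "(\<mu> has_derivative D (\<lambda>y. hessian G h y e e / G y e e) x) (at x)"
  proof (rule has_derivative_transform_within_open[OF _ open_U x])
    show "hessian G h y e e / G y e e = \<mu> y" if "y \<in> U" for y
      using pos_G[OF that e0] by (simp add: hessian_eq[OF that])
  qed
  then show ?thesis by (rule differentiableI)
qed

text \<open>
  Since the covariant derivative of \<open>grad h\<close> in the direction \<open>u\<close> is \<open>\<mu> u\<close>, applying two covariant
  derivatives and antisymmetrizing leaves only the derivatives of \<open>\<mu>\<close>.  The symmetry used is that of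
  the second coordinate derivatives of \<open>grad h\<close>.
\<close>

lemma curvature_grad:
  assumes x: "x \<in> U"
  shows "curvature G x u v (grad h x) = D \<mu> x u *\<^sub>R v - D \<mu> x v *\<^sub>R u"
proof -
  let ?\<nu> = "grad h" and ?\<Gamma> = "christoffel G"
  have D_grad: "D ?\<nu> y v = \<mu> y *\<^sub>R v - ?\<Gamma> y v (?\<nu> y)" if "y \<in> U" for y v
    using nabla_grad[OF that, of v] by (simp add: algebra_simps)
  have "((\<lambda>y. \<mu> y *\<^sub>R v - ?\<Gamma> y v (?\<nu> y)) has_derivative
      (\<lambda>k. D \<mu> x k *\<^sub>R v - (D (\<lambda>y. ?\<Gamma> y v (?\<nu> x)) x k + ?\<Gamma> x v (D ?\<nu> x k)))) (at x)" for v
    by (intro has_derivative_diff has_derivative_scaleR_left D_has_derivative differentiable_factor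
        x differentiable_grad has_derivative_linear_family[OF open_U x linear_christoffel_right]
        differentiable_christoffel)
  then have D2: "((\<lambda>y. D ?\<nu> y v) has_derivative
      (\<lambda>k. D \<mu> x k *\<^sub>R v - (D (\<lambda>y. ?\<Gamma> y v (?\<nu> x)) x k + ?\<Gamma> x v (D ?\<nu> x k)))) (at x)" for v
    by (rule has_derivative_transform_within_open[OF _ open_U x]) (simp add: D_grad)
  have "D (\<lambda>y. D ?\<nu> y v) x u = D (\<lambda>y. D ?\<nu> y u) x v"
    by (rule symmetric_second_derivative_euclidean[OF open_U x differentiable_grad differentiableI[OF D2]])
  then show ?thesis
    unfolding D_eqI[OF D2] curvature_def D_grad[OF x]
    by (simp add: christoffel_arith[OF x] christoffel_sym[OF x, of v u] algebra_simps)
qed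

text \<open>
  The trace of the preceding identity.  On a Ricci flat manifold of dimension at least two it forces
  \<open>\<mu>\<close> to be locally constant.
\<close>

lemma ricci_grad:
  assumes x: "x \<in> U"
  shows "ricci G x v (grad h x) = - (real DIM('e) - 1) * D \<mu> x v"
proof -
  have "(\<Sum>b\<in>Basis. D \<mu> x b * (v \<bullet> b)) = D \<mu> x v"
    using linear_basis_expansion[OF linear_D[OF differentiable_factor[OF x]], of v]
    by (simp add: mult.commute)
  then show ?thesis
    by (simp add: ricci_def curvature_grad[OF x] inner_diff_left sum_subtractf algebra_simps)
qed

end

end

end

end

section \<open>The static metric in a chart\<close>

lemma has_derivative_comp_fst:
  "(k has_derivative k') (at x) \<Longrightarrow> ((\<lambda>y. k (fst y)) has_derivative (\<lambda>w. k' (fst w))) (at (x, t))"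
  using has_derivative_compose[OF has_derivative_fst[OF has_derivative_ident], of k k' "(x, t)" UNIV]
  by simp

lemma has_derivative_slice:
  assumes "k differentiable (at (x, t))"
  shows "((\<lambda>y. k (y, t)) has_derivative (\<lambda>v. D k (x, t) (v, 0))) (at x)"
  using has_derivative_compose[OF has_derivative_Pair[OF has_derivative_ident has_derivative_const]
      D_has_derivative[OF assms]] .

lemma has_derivative_fibre:
  fixes k :: "'a::real_normed_vector \<times> real \<Rightarrow> real"
  assumes k: "k differentiable (at (x, t))"
  shows "((\<lambda>s. k (x, s)) has_real_derivative D k (x, t) (0, 1)) (at t)"
proof -
  have "((\<lambda>s. k (x, s)) has_derivative (\<lambda>r. D k (x, t) (0, r))) (at t)"
    using has_derivative_compose[OF has_derivative_Pair[OF has_derivative_const has_derivative_ident]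
      D_has_derivative[OF k]] .
  moreover have "(\<lambda>r. D k (x, t) (0, r)) = (*) (D k (x, t) (0, 1))"
  proof
    fix r show "D k (x, t) (0, r) = D k (x, t) (0, 1) * r"
      using linear_scale[OF linear_D[OF k], of r "(0, 1)"] by (simp add: mult.commute)
  qed
  ultimately show ?thesis by (simp add: has_field_derivative_def)
qed

lemma sum_Basis_prod:
  fixes k :: "'a::euclidean_space \<times> 'b::euclidean_space \<Rightarrow> 'c::comm_monoid_add"
  shows "(\<Sum>b\<in>Basis. k b) = (\<Sum>e\<in>Basis. k (e, 0)) + (\<Sum>s\<in>Basis. k (0, s))"
proof -
  have "inj_on (\<lambda>u. (u::'a, 0::'b)) Basis" "inj_on (\<lambda>u. (0::'a, u::'b)) Basis"
    by (auto intro: inj_onI)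
  then show ?thesis
    unfolding Basis_prod_def by (subst sum.union_disjoint) (auto simp: Basis_prod_def sum.reindex)
qed

definition static_form :: "'e form_field \<Rightarrow> ('e \<Rightarrow> real) \<Rightarrow> ('e::euclidean_space \<times> real) form_field" where
  "static_form G F = (\<lambda>(x, t) (u, a) (v, b). G x u v - (F x)\<^sup>2 * (a * b))"

lemma static_form_simp [simp]:
  "static_form G F (x, t) (u, a) (v, b) = G x u v - (F x)\<^sup>2 * (a * b)"
  by (simp add: static_form_def)

locale static_chart = riemannian_form U G for U :: "'e::euclidean_space set" and G +
  fixes F :: "'e \<Rightarrow> real"
  assumes smooth_F: "smooth_on U F" and pos_F: "x \<in> U \<Longrightarrow> F x > 0"
begin

abbreviation "sG \<equiv> static_form G F"

lemma differentiable_F: "x \<in> U \<Longrightarrow> F differentiable (at x)"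
  using smooth_on_differentiable[OF smooth_F] .

lemma differentiable_D_F: "x \<in> U \<Longrightarrow> (\<lambda>y. D F y v) differentiable (at x)"
  using smooth_on_D_differentiable[OF smooth_F open_U] .

lemma G_grad_F: "x \<in> U \<Longrightarrow> G x (grad F x) w = D F x w"
  by (rule G_grad[OF differentiable_F differentiable_D_F])

lemma differentiable_grad_F: "x \<in> U \<Longrightarrow> grad F differentiable (at x)"
  by (rule differentiable_grad[OF differentiable_F differentiable_D_F])

lemma linear_D_F: "x \<in> U \<Longrightarrow> linear (D F x)"
  by (rule linear_D[OF differentiable_F])

lemma laplacian_F:
  "x \<in> U \<Longrightarrow> laplacian G F x
     = (\<Sum>b\<in>Basis. (D (grad F) x b + christoffel G x b (grad F x)) \<bullet> b)"
  by (rule laplacian_eq[OF differentiable_F differentiable_D_F])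

lemma bilinear_static_form:
  assumes x: "x \<in> U" shows "bilinear (sG (x, t))"
  unfolding bilinear_def
proof (intro conjI allI)
  fix V show "linear (sG (x, t) V)"
    by (cases V; rule linearI) (auto simp: G_arith[OF x] algebra_simps)
  show "linear (\<lambda>W. sG (x, t) W V)"
    by (cases V; rule linearI) (auto simp: G_arith[OF x] algebra_simps)
qed

lemma static_form_nondegenerate:
  assumes x: "x \<in> U" and V: "\<And>W. sG (x, t) V W = 0" shows "V = 0"
proof -
  obtain u a where [simp]: "V = (u, a)" by fastforce
  have "G x u w = 0" for w using V[of "(w, 0)"] by simp
  then have "u = 0" by (rule G_nondegenerate[OF x])
  moreover have "a = 0" using V[of "(0, 1)"] pos_F[OF x] by (simp add: G_arith[OF x])
  ultimately show ?thesis by (simp add: zero_prod_def)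
qed

lemma D_static_form:
  assumes x: "x \<in> U"
  shows "D (\<lambda>y. sG y (v, b) (w, c)) (x, t) (u, a) = D (\<lambda>y. G y v w) x u - 2 * F x * D F x u * (b * c)"
proof -
  have "((\<lambda>y. G y v w - (F y * F y) * (b * c)) has_derivative
      (\<lambda>k. D (\<lambda>y. G y v w) x k - (F x * D F x k + D F x k * F x) * (b * c))) (at x)"
    by (intro has_derivative_diff has_derivative_mult_left has_derivative_mult D_has_derivative
        differentiable_G differentiable_F x)
  from D_eqI[OF has_derivative_comp_fst[OF this, of t]]
  have "D (\<lambda>y. G (fst y) v w - (F (fst y) * F (fst y)) * (b * c)) (x, t) (u, a)
      = D (\<lambda>y. G y v w) x u - (F x * D F x u + D F x u * F x) * (b * c)" by simp
  moreover have "(\<lambda>y. sG y (v, b) (w, c)) = (\<lambda>y. G (fst y) v w - (F (fst y) * F (fst y)) * (b * c))"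
    by (auto simp: power2_eq_square)
  ultimately show ?thesis by (simp add: algebra_simps)
qed

text \<open>
  The right hand side satisfies the Koszul formula of the static metric, whose only derivatives
  beyond those of \<open>G\<close> are the spatial ones of \<open>F\<^sup>2\<close>.
\<close>

lemma christoffel_static:
  assumes x: "x \<in> U"
  shows "christoffel sG (x, t) (u, a) (v, b) =
     (christoffel G x u v + (a * b * F x) *\<^sub>R grad F x, (a * D F x v + b * D F x u) / F x)"
  unfolding christoffel_def[of sG]
proof (rule sharp_eqI[OF bilinear_static_form[OF x] static_form_nondegenerate[OF x]])
  show "sG (x, t) (christoffel G x u v + (a * b * F x) *\<^sub>R grad F x, (a * D F x v + b * D F x u) / F x) W =
     (D (\<lambda>y. sG y (v, b) W) (x, t) (u, a) + D (\<lambda>y. sG y (u, a) W) (x, t) (v, b)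
      - D (\<lambda>y. sG y (u, a) (v, b)) (x, t) W) / 2" for W
  proof (cases W)
    case [simp]: (Pair w c)
    have "(F x)\<^sup>2 * ((a * D F x v + b * D F x u) / F x * c) = F x * (a * D F x v + b * D F x u) * c"
      using pos_F[OF x] by (simp add: power2_eq_square)
    then show ?thesis
      by (simp add: D_static_form[OF x] G_arith[OF x] G_christoffel[OF x] G_grad_F[OF x])
        (simp add: field_simps)
  qed
qed

lemma D_christoffel_static:
  assumes x: "x \<in> U"
  shows "D (\<lambda>y. christoffel sG y (v, a) (w, b)) (x, t) (u, s) =
     (D (\<lambda>y. christoffel G y v w) x u + (a * b) *\<^sub>R (F x *\<^sub>R D (grad F) x u + D F x u *\<^sub>R grad F x),
      ((a * D (\<lambda>y. D F y w) x u + b * D (\<lambda>y. D F y v) x u) * F x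
        - (a * D F x w + b * D F x v) * D F x u) / (F x * F x))"
proof -
  have F0: "F x \<noteq> 0" using pos_F[OF x] by simp
  have "((\<lambda>y. (christoffel G y v w + (a * b) *\<^sub>R (F y *\<^sub>R grad F y), (a * D F y w + b * D F y v) / F y))
     has_derivative (\<lambda>k. (D (\<lambda>y. christoffel G y v w) x k
          + (a * b) *\<^sub>R (F x *\<^sub>R D (grad F) x k + D F x k *\<^sub>R grad F x),
      ((a * D (\<lambda>y. D F y w) x k + b * D (\<lambda>y. D F y v) x k) * F x
        - (a * D F x w + b * D F x v) * D F x k) / (F x * F x)))) (at x)"
    by (intro has_derivative_Pair has_derivative_add has_derivative_scaleR_right has_derivative_scaleR
        has_derivative_divide' has_derivative_mult_right D_has_derivative differentiable_christoffel
        differentiable_F differentiable_D_F differentiable_grad_F x F0)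
  from D_eqI[OF has_derivative_comp_fst[OF this, of t]] show ?thesis
    using D_cong[OF open_Times[OF open_U open_UNIV], of "(x, t)" "\<lambda>y. christoffel sG y (v, a) (w, b)"
        "\<lambda>y. (christoffel G (fst y) v w + (a * b) *\<^sub>R (F (fst y) *\<^sub>R grad F (fst y)),
            (a * D F (fst y) w + b * D F (fst y) v) / F (fst y))"] x
    by (auto simp: christoffel_static mult.assoc)
qed

text \<open>
  In the trace, the directions tangent to the slice contribute the Ricci tensor of \<open>G\<close> and, in the
  time-time component, \<open>F\<close> times the Laplacian; the time direction contributes the Hessian of \<open>F\<close>.
  There are no mixed components.
\<close>

lemma ricci_static:
  assumes x: "x \<in> U"
  shows "ricci sG (x, t) (v, a) (w, b) =
    ricci G x v w - hessian G F x v w / F x + a * b * F x * laplacian G F x"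
proof -
  have F0: "F x \<noteq> 0" using pos_F[OF x] by simp
  have horizontal: "curvature sG (x, t) (e, 0) (v, a) (w, b) \<bullet> (e, 0) =
      curvature G x e v w \<bullet> e
      + a * b * F x * ((D (grad F) x e + christoffel G x e (grad F x)) \<bullet> e)" for e
    using F0
    by (simp add: curvature_def D_christoffel_static[OF x] christoffel_static[OF x]
        christoffel_arith[OF x] inner_simps linear_0[OF linear_D_F[OF x]] algebra_simps)
  have zero: "D (\<lambda>y. D F y 0) x v = 0"
    by (rule linear_0[OF linear_D_family[where L="D F", OF open_U x linear_D_F differentiable_D_F[OF x]]])
  have vertical: "curvature sG (x, t) (0, 1) (v, a) (w, b) \<bullet> (0, 1) = - hessian G F x v w / F x"
    using F0
    by (simp add: curvature_def hessian_def D_christoffel_static[OF x] christoffel_static[OF x]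
        christoffel_arith[OF x] zero linear_0[OF linear_D_F[OF x]]
        linear_add[OF linear_D_F[OF x]] linear_scale[OF linear_D_F[OF x]]
        linear_0[OF linear_D[OF differentiable_christoffel[OF x]]]
        linear_0[OF linear_D[OF differentiable_D_F[OF x]]])
       (simp add: field_simps)
  show ?thesis
    unfolding ricci_def[of sG] sum_Basis_prod
      laplacian_F[OF x] ricci_def[of G]
    by (simp add: horizontal vertical sum.distrib sum_distrib_left)
qed

end

section \<open>Gradient solitons on a static chart\<close>

text \<open>
  The situation in one chart: \<open>F\<close>, \<open>\<Phi>\<close> and \<open>\<Lambda>\<close> represent the warping function, the soliton
  potential and the soliton function.  On a Ricci flat base the perfect fluid equation says that
  the Hessian of \<open>F\<close> is a multiple of the metric.
\<close>

locale static_soliton = static_chart U G F for U :: "'e::euclidean_space set" and G F +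
  fixes \<mu> :: "'e \<Rightarrow> real" and \<Phi> \<Lambda> :: "'e \<times> real \<Rightarrow> real" and t0 :: real
  assumes dim: "DIM('e) \<ge> 2"
    and ricci_zero: "x \<in> U \<Longrightarrow> ricci G x u v = 0"
    and hessian_F: "x \<in> U \<Longrightarrow> hessian G F x u v = \<mu> x * G x u v"
    and smooth_\<Phi>: "smooth_on (U \<times> UNIV) \<Phi>"
    and soliton: "x \<in> U \<Longrightarrow> hessian sG \<Phi> (x, t) V W + ricci sG (x, t) V W + \<Lambda> (x, t) * sG (x, t) V W = 0"
    and slice_hessian: "x \<in> U \<Longrightarrow> hessian G (\<lambda>y. \<Phi> (y, t0)) x u v = 0"
begin

definition slice :: "real \<Rightarrow> 'e \<Rightarrow> real" where "slice t = (\<lambda>y. \<Phi> (y, t))"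

definition \<psi> :: "'e \<times> real \<Rightarrow> real" where "\<psi> p = D \<Phi> p (0, 1)"

lemma open_UT: "open (U \<times> (UNIV :: real set))"
  by (intro open_Times open_U open_UNIV)

lemma differentiable_\<Phi>: "x \<in> U \<Longrightarrow> \<Phi> differentiable (at (x, t))"
  using smooth_on_differentiable[OF smooth_\<Phi>, of "(x, t)"] by simp

lemma differentiable_D_\<Phi>: "x \<in> U \<Longrightarrow> (\<lambda>p. D \<Phi> p V) differentiable (at (x, t))"
  using smooth_on_D_differentiable[OF smooth_\<Phi> open_UT, of "(x, t)"] by simp

lemma differentiable_\<psi>: "x \<in> U \<Longrightarrow> \<psi> differentiable (at (x, t))"
  unfolding \<psi>_def[abs_def] by (rule differentiable_D_\<Phi>)

lemma has_derivative_slice_\<Phi>: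
  "x \<in> U \<Longrightarrow> (slice t has_derivative (\<lambda>v. D \<Phi> (x, t) (v, 0))) (at x)"
  unfolding slice_def by (rule has_derivative_slice[OF differentiable_\<Phi>])

lemma D_slice: "x \<in> U \<Longrightarrow> D (slice t) x v = D \<Phi> (x, t) (v, 0)"
  using D_eqI[OF has_derivative_slice_\<Phi>] by metis

lemma differentiable_slice: "x \<in> U \<Longrightarrow> slice t differentiable (at x)"
  using has_derivative_slice_\<Phi> by (rule differentiableI)

lemma has_derivative_D_slice:
  assumes x: "x \<in> U"
  shows "((\<lambda>y. D (slice t) y v) has_derivative (\<lambda>u. D (\<lambda>p. D \<Phi> p (v, 0)) (x, t) (u, 0))) (at x)"
  by (rule has_derivative_transform_within_open[OF
        has_derivative_slice[OF differentiable_D_\<Phi>[OF x]] open_U x]) (simp add: D_slice)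

lemma differentiable_D_slice: "x \<in> U \<Longrightarrow> (\<lambda>y. D (slice t) y v) differentiable (at x)"
  using has_derivative_D_slice by (rule differentiableI)

lemma hessian_horizontal:
  assumes x: "x \<in> U"
  shows "hessian sG \<Phi> (x, t) (u, 0) (v, 0) = hessian G (slice t) x u v"
  unfolding hessian_def D_eqI[OF has_derivative_D_slice[OF x]] D_slice[OF x]
  by (simp add: christoffel_static[OF x])

lemma hessian_mixed:
  assumes x: "x \<in> U"
  shows "hessian sG \<Phi> (x, t) (u, 0) (0, 1) = D \<psi> (x, t) (u, 0) - D F x u / F x * \<psi> (x, t)"
  using linear_scale[OF linear_D[OF differentiable_\<Phi>[OF x]], of t "D F x u / F x" "(0, 1)"]
  by (simp add: hessian_def christoffel_static[OF x] christoffel_arith[OF x] \<psi>_def[abs_def])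

lemma hessian_vertical:
  assumes x: "x \<in> U"
  shows "hessian sG \<Phi> (x, t) (0, 1) (0, 1) = D \<psi> (x, t) (0, 1) - F x * D (slice t) x (grad F x)"
  using linear_scale[OF linear_D[OF differentiable_\<Phi>[OF x]], of t "F x" "(grad F x, 0)"]
  by (simp add: hessian_def christoffel_static[OF x] christoffel_arith[OF x] \<psi>_def[abs_def]
      linear_0[OF linear_D_F[OF x]] D_slice[OF x])

lemma nabla_grad_F:
  "x \<in> U \<Longrightarrow> D (grad F) x u + christoffel G x u (grad F x) = \<mu> x *\<^sub>R u"
  by (rule nabla_grad[OF differentiable_F differentiable_D_F hessian_F])

lemma laplacian_\<mu>: "x \<in> U \<Longrightarrow> laplacian G F x = real DIM('e) * \<mu> x"
  by (rule laplacian_factor[OF differentiable_F differentiable_D_F hessian_F])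

text \<open>
  Ricci flatness and the dimension make \<open>\<mu>\<close> locally constant.
\<close>

lemma has_derivative_\<mu>:
  assumes x: "x \<in> U"
  shows "(\<mu> has_derivative (\<lambda>h. 0)) (at x)"
proof -
  have "\<mu> differentiable (at x)"
    by (rule differentiable_factor[OF differentiable_F differentiable_D_F hessian_F smooth_F x])
  moreover have "ricci G x v (grad F x) = - (real DIM('e) - 1) * D \<mu> x v" for v
    by (rule ricci_grad[OF differentiable_F differentiable_D_F hessian_F smooth_F x])
  then have "D \<mu> x v = 0" for v using ricci_zero[OF x] dim by simp
  then have "D \<mu> x = (\<lambda>h. 0)" by blast
  ultimately show ?thesis using D_has_derivative by metis
qed

lemma soliton_mixed:
  assumes x: "x \<in> U"
  shows "D \<psi> (x, t) (u, 0) = D F x u / F x * \<psi> (x, t)"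
  using soliton[OF x, of t "(u, 0)" "(0, 1)"]
  by (simp add: hessian_mixed[OF x] ricci_static[OF x] ricci_zero[OF x] hessian_F[OF x] G_arith[OF x])

lemma soliton_horizontal:
  assumes x: "x \<in> U"
  shows "hessian G (slice t) x u v = (\<mu> x / F x - \<Lambda> (x, t)) * G x u v"
  using soliton[OF x, of t "(u, 0)" "(v, 0)"]
  by (simp add: hessian_horizontal[OF x] ricci_static[OF x] ricci_zero[OF x] hessian_F[OF x] algebra_simps)

lemma soliton_vertical:
  assumes x: "x \<in> U"
  shows "D \<psi> (x, t) (0, 1) =
    F x * (D (slice t) x (grad F x) - real DIM('e) * \<mu> x + \<Lambda> (x, t) * F x)"
  using soliton[OF x, of t "(0, 1)" "(0, 1)"]
  by (simp add: hessian_vertical[OF x] ricci_static[OF x] ricci_zero[OF x] hessian_F[OF x]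
      G_arith[OF x] laplacian_\<mu>[OF x] power2_eq_square algebra_simps)

text \<open>
  The soliton equations are overdetermined.  Near a point the mixed equation integrates to
  \<open>\<Phi> (y, t) = \<Phi> (y, t0) + K t F y\<close>, and the slice condition gives that the Hessian of \<open>\<Phi>\<close> on the
  slice \<open>t\<close> is \<open>K t \<mu> G\<close>.  The horizontal equation then determines \<open>\<Lambda>\<close>, and the vertical one equates a
  function of \<open>t\<close> alone with an expression whose spatial derivative is \<open>\<mu>\<close> times that of \<open>\<Phi>\<close>.  If the
  constant \<open>\<mu>\<close> were not zero, \<open>\<Phi>\<close> would be spatially constant on every slice; then \<open>K = 0\<close>, so that \<open>\<Phi>\<close>
  would not depend on \<open>t\<close> either, and the vertical equation would read \<open>(n - 1) \<mu> = 0\<close>.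
\<close>

lemma factor_zero:
  assumes x0: "x0 \<in> U"
  shows "\<mu> x0 = 0"
proof (rule ccontr)
  assume "\<mu> x0 \<noteq> 0"
  define c where "c = \<mu> x0"
  have c: "c \<noteq> 0" unfolding c_def by fact
  obtain d where d: "d > 0" "ball x0 d \<subseteq> U" using openE[OF open_U x0] by blast
  define B where "B = ball x0 d"
  have B: "open B" "connected B" "x0 \<in> B" and BU: "\<And>y. y \<in> B \<Longrightarrow> y \<in> U"
    using d unfolding B_def by (auto intro: convex_connected)
  have \<mu>: "\<mu> y = c" if "y \<in> B" for y
    unfolding c_def using that B BU
    by (intro has_derivative_zero_unique_connected[of B \<mu>] has_derivative_\<mu>) auto
  have F0: "F y \<noteq> 0" if "y \<in> B" for y using pos_F[OF BU[OF that]] by simp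
  \<comment> \<open>The mixed equation says that \<open>\<psi> / F\<close> has no spatial derivative.\<close>
  have \<psi>: "\<psi> (y, t) = F y * (\<psi> (x0, t) / F x0)" if y: "y \<in> B" for y t
  proof -
    have "((\<lambda>y. \<psi> (y, t) / F y) has_derivative (\<lambda>h. 0)) (at x)" if x: "x \<in> B" for x
    proof -
      have "((\<lambda>y. \<psi> (y, t) / F y) has_derivative
         (\<lambda>h. (D \<psi> (x, t) (h, 0) * F x - \<psi> (x, t) * D F x h) / (F x * F x))) (at x)"
        by (intro has_derivative_divide' has_derivative_slice differentiable_\<psi> D_has_derivative
            differentiable_F BU F0 x)
      then show ?thesis using F0[OF x] by (simp add: soliton_mixed[OF BU[OF x]])
    qed
    then have "\<psi> (y, t) / F y = \<psi> (x0, t) / F x0"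
      using B y by (intro has_derivative_zero_unique_connected[of B "\<lambda>y. \<psi> (y, t) / F y"]) auto
    then show ?thesis using F0[OF y] by (simp add: field_simps)
  qed
  define K where "K t = (\<Phi> (x0, t) - \<Phi> (x0, t0)) / F x0" for t
  have K': "(K has_real_derivative \<psi> (x0, t) / F x0) (at t)" for t
  proof -
    have "((\<lambda>t. \<Phi> (x0, t)) has_real_derivative \<psi> (x0, t)) (at t)"
      unfolding \<psi>_def by (rule has_derivative_fibre[OF differentiable_\<Phi>[OF x0]])
    from DERIV_cdivide[OF DERIV_diff[OF this DERIV_const]]
    show ?thesis unfolding K_def[abs_def] by simp
  qed
  have split: "slice t y = slice t0 y + K t * F y" if y: "y \<in> B" for t y
  proof -
    have "((\<lambda>s. \<Phi> (y, s) - K s * F y) has_real_derivative (\<psi> (y, s) - \<psi> (x0, s) / F x0 * F y)) (at s)" for s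
      unfolding \<psi>_def[of "(y, s)"]
      by (intro DERIV_diff DERIV_cmult_right K' has_derivative_fibre differentiable_\<Phi> BU y)
    then have "\<forall>s. ((\<lambda>s. \<Phi> (y, s) - K s * F y) has_real_derivative 0) (at s)"
      using \<psi>[OF y] by simp
    from DERIV_isconst_all[OF this, of t t0] show ?thesis by (simp add: slice_def K_def)
  qed
  have D_split: "D (slice t) y v = D (slice t0) y v + K t * D F y v" if y: "y \<in> B" for t y v
  proof -
    have "((\<lambda>y. slice t0 y + K t * F y) has_derivative (\<lambda>v. D (slice t0) y v + K t * D F y v)) (at y)"
      by (intro has_derivative_add has_derivative_mult_right D_has_derivative differentiable_slice
          differentiable_F BU y)
    from D_eqI[OF this] have "D (\<lambda>y. slice t0 y + K t * F y) y v = D (slice t0) y v + K t * D F y v"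
      by simp
    moreover have "D (slice t) y = D (\<lambda>y. slice t0 y + K t * F y) y"
      by (rule D_cong[OF B(1) y split])
    ultimately show ?thesis by simp
  qed
  have hessian_split: "hessian G (slice t) y u v = K t * c * G y u v" if y: "y \<in> B" for t y u v
  proof -
    have "((\<lambda>y. D (slice t0) y v + K t * D F y v) has_derivative
        (\<lambda>u. D (\<lambda>y. D (slice t0) y v) y u + K t * D (\<lambda>y. D F y v) y u)) (at y)"
      by (intro has_derivative_add has_derivative_mult_right D_has_derivative differentiable_D_slice
          differentiable_D_F BU y)
    from D_eqI[OF this]
    have "D (\<lambda>y. D (slice t0) y v + K t * D F y v) y u
        = D (\<lambda>y. D (slice t0) y v) y u + K t * D (\<lambda>y. D F y v) y u" by simp
    moreover have "D (\<lambda>y. D (slice t) y v) y = D (\<lambda>y. D (slice t0) y v + K t * D F y v) y"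
      by (rule D_cong[OF B(1) y D_split])
    ultimately have "hessian G (slice t) y u v = hessian G (slice t0) y u v + K t * hessian G F y u v"
      by (simp add: hessian_def D_split[OF y, of t] algebra_simps)
    then show ?thesis
      using slice_hessian[OF BU[OF y]] hessian_F[OF BU[OF y]] \<mu>[OF y] by (simp add: slice_def)
  qed
  obtain e :: 'e where "e \<in> Basis" using nonempty_Basis by blast
  then have e0: "e \<noteq> 0" by auto
  have \<Lambda>: "\<Lambda> (y, t) = c / F y - K t * c" if y: "y \<in> B" for y t
  proof -
    have "(c / F y - \<Lambda> (y, t)) * G y e e = hessian G (slice t) y e e"
      using soliton_horizontal[OF BU[OF y], of t e e] unfolding \<mu>[OF y] by (rule sym)
    also have "\<dots> = K t * c * G y e e" by (rule hessian_split[OF y])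
    finally have "(c / F y - \<Lambda> (y, t)) * G y e e = K t * c * G y e e" .
    moreover have "G y e e \<noteq> 0" using pos_G[OF BU[OF y] e0] by simp
    ultimately have "c / F y - \<Lambda> (y, t) = K t * c" by simp
    then show ?thesis by linarith
  qed
  define k where "k t = D \<psi> (x0, t) (0, 1) / F x0" for t
  have vertical: "k t = D (slice t) y (grad F y) - (real DIM('e) - 1) * c - K t * c * F y"
    if y: "y \<in> B" for y t
  proof -
    have 1: "((\<lambda>s. \<psi> (y, s)) has_real_derivative D \<psi> (y, t) (0, 1)) (at t)"
      by (intro has_derivative_fibre differentiable_\<psi> BU y)
    have "((\<lambda>s. \<psi> (x0, s)) has_real_derivative D \<psi> (x0, t) (0, 1)) (at t)"
      by (intro has_derivative_fibre differentiable_\<psi> x0)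
    from DERIV_cmult[OF DERIV_cdivide[OF this], of "F y" "F x0"]
    have "((\<lambda>s. \<psi> (y, s)) has_real_derivative F y * k t) (at t)"
      unfolding k_def \<psi>[OF y] .
    with 1 have eq: "D \<psi> (y, t) (0, 1) = F y * k t" by (rule DERIV_unique)
    have "F y * k t = F y * (D (slice t) y (grad F y) - real DIM('e) * c + \<Lambda> (y, t) * F y)"
      using soliton_vertical[OF BU[OF y], of t] unfolding \<mu>[OF y] eq .
    then have "k t = D (slice t) y (grad F y) - real DIM('e) * c + \<Lambda> (y, t) * F y"
      unfolding mult_left_cancel[OF F0[OF y]] .
    moreover have "\<Lambda> (y, t) * F y = c - K t * c * F y"
      using F0[OF y] by (simp add: \<Lambda>[OF y] left_diff_distrib)
    ultimately show ?thesis by (simp add: left_diff_distrib)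
  qed
  \<comment> \<open>Differentiate \<open>vertical\<close> along the slice; the terms with \<open>K t\<close> cancel by symmetry of the metric.\<close>
  have D_slice_zero: "D (slice t) y u = 0" if y: "y \<in> B" for t y u
  proof -
    have yU: "y \<in> U" by (rule BU[OF y])
    have "((\<lambda>y. D (slice t) y (grad F y)) has_derivative
       (\<lambda>u. hessian G (slice t) y u (grad F y)
         + D (slice t) y (D (grad F) y u + christoffel G y u (grad F y)))) (at y)"
      by (rule has_derivative_D_field[OF differentiable_slice differentiable_D_slice yU
            D_has_derivative[OF differentiable_grad_F[OF yU]]])
    from has_derivative_diff[OF has_derivative_diff[OF this has_derivative_const]
        has_derivative_mult_right[OF D_has_derivative[OF differentiable_F[OF yU]]]]
    have "((\<lambda>y. D (slice t) y (grad F y) - (real DIM('e) - 1) * c - K t * c * F y) has_derivative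
       (\<lambda>u. K t * c * G y u (grad F y) + D (slice t) y (c *\<^sub>R u) - 0 - K t * c * D F y u)) (at y)"
      unfolding hessian_split[OF y] nabla_grad_F[OF yU] \<mu>[OF y] .
    then have "((\<lambda>y. k t) has_derivative
       (\<lambda>u. K t * c * G y u (grad F y) + D (slice t) y (c *\<^sub>R u) - 0 - K t * c * D F y u)) (at y)"
      by (rule has_derivative_transform_within_open[OF _ B(1) y]) (simp add: vertical)
    from D_eqI[OF this]
    have "K t * c * G y u (grad F y) + D (slice t) y (c *\<^sub>R u) - 0 - K t * c * D F y u = 0"
      by (simp add: fun_eq_iff)
    then have "c * D (slice t) y u = 0"
      using sym_G[OF yU, of u "grad F y"] G_grad_F[OF yU, of u]
        linear_scale[OF linear_D[OF differentiable_slice[OF yU]], of t c u] by simp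
    then show ?thesis using c by simp
  qed
  have "K t = 0" for t
  proof -
    have "hessian G (slice t) x0 e e = 0"
    proof -
      have "D (\<lambda>y. D (slice t) y e) x0 = D (\<lambda>y. 0) x0"
        by (rule D_cong[OF B(1,3) D_slice_zero])
      then show ?thesis by (simp add: hessian_def D_slice_zero[OF B(3)])
    qed
    then show ?thesis using hessian_split[OF B(3), of t e e] c pos_G[OF x0 e0] by simp
  qed
  then have K0: "K = (\<lambda>t. 0)" by blast
  have "\<psi> (x0, t) / F x0 = 0" for t
    by (rule DERIV_unique[OF K'[of t, unfolded K0] DERIV_const])
  then have \<psi>0: "(\<lambda>s. \<psi> (x0, s)) = (\<lambda>s. 0)" using F0[OF B(3)] by simp
  have "D \<psi> (x0, t0) (0, 1) = 0"
    by (rule DERIV_unique[OF has_derivative_fibre[OF differentiable_\<psi>[OF x0], unfolded \<psi>0] DERIV_const])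
  then have "k t0 = 0" by (simp add: k_def)
  then show False
    using vertical[OF B(3), of t0] K0 D_slice_zero[OF B(3)] c dim by simp
qed

end

section \<open>From charts to the manifold\<close>

text \<open>
  Chart representatives are determined on the coordinate domain only, so that the restriction of a
  representative to a slice and the representative of the restriction agree just there.
\<close>

lemma hessian_cong:
  assumes S: "open S" "x \<in> S" and eq: "\<And>y. y \<in> S \<Longrightarrow> h y = k y"
  shows "hessian G h x = hessian G k x"
proof -
  have D: "D h y = D k y" if "y \<in> S" for y by (rule D_cong[OF S(1) that eq])
  have "D (\<lambda>y. D h y v) x = D (\<lambda>y. D k y v) x" for v
    by (rule D_cong[OF S]) (simp add: D)
  then show ?thesis by (simp add: hessian_def fun_eq_iff D[OF S(2)])
qed

lemma riemannian_form_chart: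
  assumes "smooth_atlas c" "riemannian_metric c g"
  shows "riemannian_form (snd (c i) ` fst (c i)) (g i)"
proof
  show "open (snd (c i) ` fst (c i))" using assms(1) unfolding smooth_atlas_def by blast
  show "smooth_on (snd (c i) ` fst (c i)) (\<lambda>x. g i x u v)" for u v
    using assms(2) unfolding riemannian_metric_def by blast
  fix x assume x: "x \<in> snd (c i) ` fst (c i)"
  show "bilinear (g i x)" using assms(2) x unfolding riemannian_metric_def by blast
  show "g i x u v = g i x v u" for u v using assms(2) x unfolding riemannian_metric_def by blast
  show "g i x u u > 0" if "u \<noteq> 0" for u
    using assms(2) x that unfolding riemannian_metric_def by blast
qed

lemma inj_on_chart:
  assumes "smooth_atlas c"
  shows "inj_on (snd (c i)) (fst (c i))"
proof -
  have "homeomorphism (fst (c i)) (snd (c i) ` fst (c i)) (snd (c i)) (inv_into (fst (c i)) (snd (c i)))"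
    using assms unfolding smooth_atlas_def by blast
  then show ?thesis by (metis homeomorphism_def inj_on_inverseI)
qed

lemma in_chart_apply:
  assumes "smooth_atlas c" "p \<in> fst (c i)"
  shows "in_chart (c i) h (snd (c i) p) = h p"
  using inj_on_chart[OF assms(1)] assms(2) by (simp add: in_chart_def)

lemma in_chart_spacetime_apply:
  assumes "smooth_atlas c" "p \<in> fst (c i)"
  shows "in_chart (spacetime_atlas c i) h (snd (c i) p, t) = h (p, t)"
proof -
  have "inj_on (map_prod (snd (c i)) id) (fst (c i) \<times> (UNIV :: real set))"
    using inj_on_chart[OF assms(1), of i] by (intro map_prod_inj_on) auto
  from inv_into_f_f[OF this, of "(p, t)"] assms(2)
  show ?thesis by (simp add: in_chart_def spacetime_atlas_def)
qed

lemma static_metric_eq: "static_metric c g f i = static_form (g i) (in_chart (c i) f)"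
  by (simp add: static_metric_def static_form_def)

theorem theorem4p2:
  fixes c :: "('i, 'm::{second_countable_topology,t2_space}, 'e::euclidean_space) atlas"
    and g :: "('i, 'e) tensor2"
    and f \<rho> :: "'m \<Rightarrow> real"
    and lam \<phi> :: "'m \<times> real \<Rightarrow> real"
    and t0 :: real
  assumes "DIM('e) \<ge> 2"
    and "smooth_atlas c"
    and "riemannian_metric c g"
    and "ricci_flat c g"
    and "smooth_fun c f"
    and "\<forall>p. f p > 0"
    and "static_perfect_fluid c g f \<rho>"
    and "almost_gradient_ricci_soliton (spacetime_atlas c) (static_metric c g f) lam \<phi>"
    and "hessian_vanishes c g (\<lambda>p. \<phi> (p, t0))"
    and "\<forall>i. \<forall>p \<in> fst (c i). \<forall>t.
           lam (p, t) \<le> - (scalar_curvature (g i) (snd (c i) p) / (real DIM('e) - 1))"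
  shows "null_convergence_condition (spacetime_atlas c) (static_metric c g f)"
proof -
  \<comment> \<open>With \<open>\<mu> = 0\<close> the formula for the Ricci tensor of the static metric leaves nothing.\<close>
  have ricci_zero_vec: "ricci (static_metric c g f i) (snd (c i) p, t) V V = 0"
    if p: "p \<in> fst (c i)" for i p t V
  proof -
    define U where "U = snd (c i) ` fst (c i)"
    define F where "F = in_chart (c i) f"
    define \<Phi> where "\<Phi> = in_chart (spacetime_atlas c i) \<phi>"
    define \<Lambda> where "\<Lambda> = in_chart (spacetime_atlas c i) lam"
    define \<mu> where "\<mu> x = laplacian (g i) F x / real DIM('e)" for x
    interpret riemannian_form U "g i"
      unfolding U_def by (rule riemannian_form_chart[OF assms(2,3)])
    have ric: "ricci (g i) x u v = 0" if "x \<in> U" for x u v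
      using that assms(4) unfolding U_def ricci_flat_def by blast
    interpret static_chart U "g i" F
    proof
      show "smooth_on U F" using assms(5) unfolding smooth_fun_def U_def F_def by blast
      show "F x > 0" if "x \<in> U" for x
        using that assms(6) by (auto simp: U_def F_def in_chart_apply[OF assms(2)])
    qed
    interpret static_soliton U "g i" F \<mu> \<Phi> \<Lambda> t0
    proof
      show "DIM('e) \<ge> 2" by (rule assms(1))
    next
      fix x u v assume x: "x \<in> U"
      then obtain q where q: "q \<in> fst (c i)" "x = snd (c i) q" unfolding U_def by blast
      show "ricci (g i) x u v = 0" by (rule ric[OF x])
      have "sharp (g i x) (ricci (g i) x b) = 0" for b
        by (rule sharp_eqI[OF bilinear_G[OF x] G_nondegenerate[OF x]]) (simp_all add: ric[OF x] G_arith[OF x])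
      then have "scalar_curvature (g i) x = 0" by (simp add: scalar_curvature_def trace_wrt_def)
      moreover have "f q * (ricci (g i) x u v - scalar_curvature (g i) x / real DIM('e) * g i x u v)
          = hessian (g i) F x u v - \<mu> x * g i x u v"
        using assms(7) q(1) unfolding static_perfect_fluid_def Let_def F_def \<mu>_def q(2) by blast
      ultimately show "hessian (g i) F x u v = \<mu> x * g i x u v" by (simp add: ric[OF x])
      have "hessian (g i) (\<lambda>y. \<Phi> (y, t0)) x = hessian (g i) (in_chart (c i) (\<lambda>p. \<phi> (p, t0))) x"
        by (rule hessian_cong[OF open_U x])
          (auto simp: U_def \<Phi>_def in_chart_spacetime_apply[OF assms(2)] in_chart_apply[OF assms(2)])
      then show "hessian (g i) (\<lambda>y. \<Phi> (y, t0)) x u v = 0"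
        using assms(9) q unfolding hessian_vanishes_def by simp
    next
      have "snd (spacetime_atlas c i) ` fst (spacetime_atlas c i) = U \<times> UNIV"
        by (auto simp: spacetime_atlas_def U_def map_prod_def image_iff)
      moreover have "smooth_on (snd (spacetime_atlas c i) ` fst (spacetime_atlas c i)) \<Phi>"
        using assms(8) unfolding almost_gradient_ricci_soliton_def smooth_fun_def \<Phi>_def by blast
      ultimately show "smooth_on (U \<times> UNIV) \<Phi>" by simp
    next
      fix x t V W assume "x \<in> U"
      then obtain q where q: "q \<in> fst (c i)" "x = snd (c i) q" unfolding U_def by blast
      then have mem: "(q, t) \<in> fst (spacetime_atlas c i)"
        and coord: "snd (spacetime_atlas c i) (q, t) = (x, t)"
        by (auto simp: spacetime_atlas_def)
      have "\<forall>p \<in> fst (spacetime_atlas c i). \<forall>u v.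
          hessian (static_metric c g f i) \<Phi> (snd (spacetime_atlas c i) p) u v
          + ricci (static_metric c g f i) (snd (spacetime_atlas c i) p) u v
          + lam p * static_metric c g f i (snd (spacetime_atlas c i) p) u v = 0"
        using assms(8) unfolding almost_gradient_ricci_soliton_def Let_def \<Phi>_def by blast
      from this[rule_format, OF mem, of V W]
      show "hessian (static_form (g i) F) \<Phi> (x, t) V W + ricci (static_form (g i) F) (x, t) V W
          + \<Lambda> (x, t) * static_form (g i) F (x, t) V W = 0"
        using in_chart_spacetime_apply[OF assms(2) q(1), of lam t]
        by (simp only: coord q(2) \<Lambda>_def F_def static_metric_eq)
    qed
    have x: "snd (c i) p \<in> U" using p unfolding U_def by blast
    show ?thesis
      using factor_zero[OF x]
      by (cases V) (simp add: static_metric_eq F_def[symmetric] ricci_static[OF x] ricci_zero[OF x]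
          hessian_F[OF x] laplacian_\<mu>[OF x])
  qed
  show ?thesis
    unfolding null_convergence_condition_def
    by (auto simp: spacetime_atlas_def ricci_zero_vec)
qed

end
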